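(* Let $\alpha,\beta\in\mathbb{R}^+$ satisfy $\alpha\beta=\pi^2$, let $E_n(x)$ denote the Euler polynomials, and let $k,m$ be positive integers. Then $$ \begin{aligned} &\alpha^{km}\sum_{n=0}^{\infty}(-1)^n(n+b)^{2km-1}\left(G_\alpha(n+b,a;k)-\frac{1}{2\pi}\sum_{p=0}^{m}(-1)^{n}E_{2kp-1}(a)\left(\frac{\pi}{\alpha}\right)^{-2kp}\right)\\ &=(-1)^{m+1}\beta^{km}\sum_{n=0}^{\infty}(-1)^n(n+a)^{2km-1}\left(G_\beta(n+a,b;k)-\frac{1}{2\pi}\sum_{p=0}^{m}(-1)^{n}E_{2kp-1}(b)\left(\frac{\pi}{\beta}\right)^{-2kp}\right)\\ &\quad+\frac{1}{4\pi}\sum_{p=0}^{m}(-1)^pE_{2kp-1}(a)\,E_{2k(m-p)-1}(b)\,\alpha^{k(m-p)}\beta^{kp}, \end{aligned} $$ where $E_{-1}(a)$ is interpreted so that $E_{-1}(a)=2\zeta_E(1,a)$ (and likewise with $b$ in place of $a$).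
   Context: The Euler polynomials are given, for $n\ge0$, by $\frac{2e^{xt}}{e^t+1}=\sum_{n\ge0}E_n(x)\frac{t^n}{n!}$. The alternating Hurwitz zeta function is $\zeta_E(z,x)=\sum_{n=0}^{\infty}\frac{(-1)^n}{(n+x)^z}$ for $\operatorname{Re}(z)>0$, $x\ne0,-1,-2,\dots$, continued analytically in $z$ to all of $\mathbb{C}$; the alternating digamma function is $\widetilde{\psi}(x)=-\zeta_E(1,x)$. For $x\in\mathbb{R}^+$, $a\in\mathbb{C}$ and a positive integer $k$, the odd-order alternating Hurwitz kernel is $$G(x,a;k)=\frac{1}{2\pi i}\int_{(c)}\frac{\zeta_E(1-s,a)}{2k\sin\left(\frac{\pi s}{2k}\right)}x^{-s}\,ds=-\frac{\widetilde{\psi}(a)}{\pi}-\frac{x^{2k}}{\pi}\sum_{n=0}^{\infty}\frac{(-1)^n}{(n+a)\left((n+a)^{2k}+x^{2k}\right)},$$ where $(c)$ is the vertical line $\operatorname{Re}(s)=c$ with $1<c<2$. Write $G_\alpha(x,a;k)=G\!\left(\frac{\alpha x}{\pi},a;k\right)$, and similarly $G_\beta$. The numbers $a,b$ are parameters for which these expressions are defined.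
   Formalization: The subtracted inner sums are corrected: (-1)^{p+1} replaces (-1)^n, (α(n+b)/π)^{-2kp} replaces (π/α)^{-2kp} (likewise with β, a), and p runs from 1 to m; as printed both series diverge, e.g. for k=m=1, a=b=1. Here a, b are positive reals. *)

theory Defs
  imports "HOL-Analysis.Analysis" "HOL-Computational_Algebra.Formal_Power_Series"
begin

definition euler_poly :: "nat \<Rightarrow> complex \<Rightarrow> complex" where
  "euler_poly n x = fact n * fps_nth (fps_const 2 * fps_exp x / (fps_exp 1 + 1)) n"

(* The alternating Hurwitz zeta function, continued in z: for x not in {0, -1, -2, ...}, the unique
   entire function that agrees with the (conditionally convergent) series on Re z > 0.
   Powers use the principal branch. *)
definition alt_hurwitz_zeta :: "complex \<Rightarrow> complex \<Rightarrow> complex" where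
  "alt_hurwitz_zeta z x =
    (THE f. f holomorphic_on UNIV \<and>
       (\<forall>w. Re w > 0 \<longrightarrow> (\<lambda>n. (-1) ^ n / (of_nat n + x) powr w) sums f w)) z"

(* E_j for j >= -1, with the convention E_{-1}(x) = 2 zeta_E(1, x). It extends the identity
   E_n(x) = 2 zeta_E(-n, x). *)
definition euler_ext :: "int \<Rightarrow> complex \<Rightarrow> complex" where
  "euler_ext j x = (if j = -1 then 2 * alt_hurwitz_zeta 1 x else euler_poly (nat j) x)"

(* The odd-order alternating Hurwitz kernel as its Mellin-Barnes integral over the line Re s = c,
   1 < c < 2: with s = c + i t, the factor ds / (2 pi i) becomes dt / (2 pi). *)
definition alt_hurwitz_kernel :: "real \<Rightarrow> real \<Rightarrow> complex \<Rightarrow> nat \<Rightarrow> complex" where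
  "alt_hurwitz_kernel c x a k =
    1 / (2 * of_real pi) *
    (LBINT t. (let s = Complex c t in
       alt_hurwitz_zeta (1 - s) a / (2 * of_nat k * sin (of_real pi * s / (2 * of_nat k)))
         * of_real x powr (- s)))"

definition alt_hurwitz_kernel_scaled ::
    "real \<Rightarrow> real \<Rightarrow> real \<Rightarrow> complex \<Rightarrow> nat \<Rightarrow> complex" where
  "alt_hurwitz_kernel_scaled c \<alpha> x a k = alt_hurwitz_kernel c (\<alpha> * x / pi) a k"

end

theory Submission
  imports Defs "HOL-Complex_Analysis.Complex_Analysis"
begin

text \<open>
  Divergent alternating sums are read as Euler sums, that is, after finitely many averaging steps
  \<open>\<Sum>(-1)^n f(n) = f(0)/2 + 1/2 \<Sum>(-1)^n (f(n) - f(n+1))\<close>. In this sense \<open>\<zeta>\<^sub>E(s,x) = \<Sum>(-1)^n (n+x)^(-s)\<close>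
  for every \<open>s\<close>, and \<open>E\<^sub>j(x)/2 = \<Sum>(-1)^n (n+x)^j\<close>. Integrating the Mellin--Barnes integrand termwise gives
  \<open>\<pi> G(x,a;k) = \<Sum>(-1)^l z^(2k-1) / (z^(2k) + x^(2k))\<close> with \<open>z = l+a\<close>, and subtracting the terms with
  Euler polynomials leaves the Euler sum of the remainders of a geometric expansion. Hence the
  left-hand series is, up to a constant, the double sum of
  \<open>(-1)^(n+l) z^(2km-1)/w * z^(2k) / (z^(2k) + (\<sigma>w)^(2k))\<close> with \<open>w = n+b\<close> and \<open>\<sigma> = \<alpha>/\<pi>\<close>. Differences of
  high order in \<open>l\<close> decay fast enough (Cauchy estimates) to interchange the summations, and
  \<open>z^(2k) / (z^(2k) + (\<sigma>w)^(2k)) = 1 - w^(2k) / (w^(2k) + (z/\<sigma>)^(2k))\<close> turns the inner sum into the kernel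
  with \<open>\<alpha>, a\<close> and \<open>\<beta>, b\<close> exchanged.
\<close>

section \<open>Euler summation of alternating series\<close>

text \<open>For fixed \<open>n\<close> the terms of the sum over \<open>l\<close> grow like
  \<open>z ^ (2 * k * m - 1)\<close>, so the double sum cannot be rearranged directly. Only its
  \<open>N\<close>-th differences in \<open>l\<close> are absolutely summable, and they need a bound
  that factors into a summable function of \<open>l\<close> and a summable function of
  \<open>n\<close>. The second factor comes from the lower bound \<open>y ^ (2 * k)\<close>, with
  \<open>y = \<sigma> w\<close>, for the modulus of the denominator. It must hold on whole complex
  discs around the points \<open>l + a\<close>, since Cauchy's inequality sees these discs. The
  discs have radius \<open>\<delta>\<close> times their centre, and
  \<open>\<delta> = 1 / (4 * real k)\<close> serves two ends. Arguments of \<open>z\<close> are then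
  at most \<open>1 / (2 * real k)\<close>, so \<open>z ^ (2 * k)\<close> stays in the right
  half-plane and cannot cancel the positive number \<open>y ^ (2 * k)\<close>. Moreover, for
  \<open>t = Im s\<close>, leaving the real axis enlarges \<open>z powr s\<close> by at most a
  constant times \<open>exp (\<bar>t\<bar> / (2 * real k))\<close>, which loses against the decay
  \<open>exp (- pi * \<bar>t\<bar> / (2 * real k))\<close> of the reciprocal sine in the
  Mellin-Barnes integral.\<close>

definition fdiff :: "(nat \<Rightarrow> complex) \<Rightarrow> nat \<Rightarrow> complex" where
  "fdiff f n = f n - f (Suc n)"

text \<open>The sign is not part of \<open>f\<close>: \<open>euler_sums N f s\<close> assigns \<open>s\<close> to \<open>\<Sum>(-1)^n f(n)\<close> after \<open>N\<close> averaging steps.\<close>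

primrec euler_sums :: "nat \<Rightarrow> (nat \<Rightarrow> complex) \<Rightarrow> complex \<Rightarrow> bool" where
  "euler_sums 0 f s \<longleftrightarrow> (\<lambda>n. (-1) ^ n * f n) sums s"
| "euler_sums (Suc N) f s \<longleftrightarrow> euler_sums N (fdiff f) (2 * s - f 0)"

lemma euler_sums_unique: "euler_sums N f s \<Longrightarrow> euler_sums N f t \<Longrightarrow> s = t"
proof (induction N arbitrary: f s t)
  case 0
  then show ?case using sums_unique2 by simp
next
  case (Suc N)
  then have "2 * s - f 0 = 2 * t - f 0" by simp
  then show ?case by simp
qed

lemma fdiff_add: "fdiff (\<lambda>n. f n + g n) = (\<lambda>n. fdiff f n + fdiff g n)"
  by (rule ext) (simp add: fdiff_def)

lemma fdiff_cmult: "fdiff (\<lambda>n. c * f n) = (\<lambda>n. c * fdiff f n)"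
  by (rule ext) (simp add: fdiff_def algebra_simps)

lemma fdiff_pow_cmult: "(fdiff ^^ N) (\<lambda>n. c * f n) = (\<lambda>n. c * (fdiff ^^ N) f n)"
  by (induction N arbitrary: f) (auto simp: fdiff_cmult funpow_swap1 simp del: funpow.simps(2) simp: funpow.simps(2)[of _ fdiff])

lemma euler_sums_add:
  "euler_sums N f s \<Longrightarrow> euler_sums N g t \<Longrightarrow> euler_sums N (\<lambda>n. f n + g n) (s + t)"
proof (induction N arbitrary: f g s t)
  case 0
  then show ?case
    using sums_add[of "\<lambda>n. (-1) ^ n * f n" s "\<lambda>n. (-1) ^ n * g n" t]
    by (simp add: algebra_simps)
next
  case (Suc N)
  then show ?case
    using Suc.IH[of "fdiff f" "2 * s - f 0" "fdiff g" "2 * t - g 0"]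
    by (simp add: fdiff_add algebra_simps)
qed

lemma euler_sums_cmult: "euler_sums N f s \<Longrightarrow> euler_sums N (\<lambda>n. c * f n) (c * s)"
proof (induction N arbitrary: f s)
  case 0
  then show ?case using sums_mult[of "\<lambda>n. (-1) ^ n * f n" s c] by (simp add: algebra_simps)
next
  case (Suc N)
  then show ?case
    using Suc.IH[of "fdiff f" "2 * s - f 0"] by (simp add: fdiff_cmult algebra_simps)
qed

lemma euler_sums_zero: "euler_sums N (\<lambda>n. 0) 0"
proof (induction N)
  case (Suc N)
  have "fdiff (\<lambda>n. 0) = (\<lambda>n. 0)" by (rule ext) (simp add: fdiff_def)
  then show ?case using Suc by simp
qed simp

lemma euler_sums_sum:
  assumes "\<And>i. i \<in> I \<Longrightarrow> euler_sums N (f i) (s i)"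
  shows "euler_sums N (\<lambda>n. \<Sum>i\<in>I. f i n) (\<Sum>i\<in>I. s i)"
  using assms
  by (induction I rule: infinite_finite_induct) (auto intro: euler_sums_add euler_sums_zero)

lemma euler_sums_diff:
  "euler_sums N f s \<Longrightarrow> euler_sums N g t \<Longrightarrow> euler_sums N (\<lambda>n. f n - g n) (s - t)"
  using euler_sums_add[of N f s "\<lambda>n. (-1) * g n" "(-1) * t"] euler_sums_cmult[of N g t "-1"]
  by simp

text \<open>The boundary term \<open>(-1) ^ M * f M\<close> is the whole obstruction to passing
  between a series and its averaged form; it vanishes in the limit when \<open>f\<close> tends to
  0.\<close>

lemma alternating_partial_sum_fdiff:
  "2 * (\<Sum>n<M. (-1) ^ n * f n) = f 0 - (-1) ^ M * f M + (\<Sum>n<M. (-1) ^ n * fdiff f n)"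
  by (induction M) (simp_all add: fdiff_def algebra_simps)

lemma alternating_sums_fdiff_iff:
  assumes "f \<longlonglongrightarrow> 0"
  shows "(\<lambda>n. (-1) ^ n * fdiff f n) sums (2 * s - f 0) \<longleftrightarrow> (\<lambda>n. (-1) ^ n * f n) sums s"
proof -
  have z: "(\<lambda>M. (-1) ^ M * f M) \<longlonglongrightarrow> 0"
    using assms by (intro tendsto_norm_zero_cancel[where f = "\<lambda>M. (-1) ^ M * f M"])
      (simp add: norm_mult norm_power tendsto_norm_zero)
  show ?thesis
  proof
    assume "(\<lambda>n. (-1) ^ n * fdiff f n) sums (2 * s - f 0)"
    then have "(\<lambda>M. (f 0 - (-1) ^ M * f M + (\<Sum>n<M. (-1) ^ n * fdiff f n)) / 2)
        \<longlonglongrightarrow> (f 0 - 0 + (2 * s - f 0)) / 2"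
      unfolding sums_def by (intro tendsto_intros z) auto
    then show "(\<lambda>n. (-1) ^ n * f n) sums s"
      unfolding sums_def alternating_partial_sum_fdiff[symmetric] by simp
  next
    assume "(\<lambda>n. (-1) ^ n * f n) sums s"
    then have "(\<lambda>M. 2 * (\<Sum>n<M. (-1) ^ n * f n) - f 0 + (-1) ^ M * f M) \<longlonglongrightarrow> 2 * s - f 0 + 0"
      unfolding sums_def by (intro tendsto_intros z) auto
    then show "(\<lambda>n. (-1) ^ n * fdiff f n) sums (2 * s - f 0)"
      unfolding sums_def alternating_partial_sum_fdiff by simp
  qed
qed

lemma euler_sums_Suc: "euler_sums N f s \<Longrightarrow> euler_sums (Suc N) f s"
proof (induction N arbitrary: f s)
  case 0
  then have "(\<lambda>n. (-1) ^ n * f n) \<longlonglongrightarrow> 0"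
    using summable_LIMSEQ_zero sums_summable by (simp, blast)
  then have "f \<longlonglongrightarrow> 0"
    using tendsto_norm_zero_iff[of "\<lambda>n. (-1) ^ n * f n"] tendsto_norm_zero_iff[of f]
    by (simp add: norm_mult norm_power)
  then show ?case using 0 alternating_sums_fdiff_iff by simp
next
  case (Suc N)
  then show ?case by (metis euler_sums.simps(2))
qed

lemma euler_sums_mono: "euler_sums N f s \<Longrightarrow> N \<le> N' \<Longrightarrow> euler_sums N' f s"
proof -
  assume f: "euler_sums N f s" and "N \<le> N'"
  from \<open>N \<le> N'\<close> show "euler_sums N' f s"
    by (induction rule: dec_induct) (rule f, erule euler_sums_Suc)
qed

text \<open>A Tauberian converse to \<open>euler_sums_mono\<close>: differences of a null sequence
  are null, so every averaging step can be undone by \<open>alternating_sums_fdiff_iff\<close>. This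
  turns Euler sums of zeta and of the kernel back into convergent series.\<close>

lemma euler_sums_null:
  assumes "f \<longlonglongrightarrow> 0" and "euler_sums N f s"
  shows "euler_sums 0 f s"
  using assms
proof (induction N arbitrary: f s)
  case (Suc N)
  have "(\<lambda>n. f n - f (Suc n)) \<longlonglongrightarrow> 0 - 0"
    by (intro tendsto_diff LIMSEQ_Suc Suc.prems)
  then have "fdiff f \<longlonglongrightarrow> 0" unfolding fdiff_def by simp
  then have "euler_sums 0 (fdiff f) (2 * s - f 0)"
    using Suc by simp
  then show ?case using alternating_sums_fdiff_iff Suc.prems(1) by simp
qed simp

text \<open>Dropping the first term reverses all remaining signs, hence
  \<open>f 0 - s\<close>.\<close>

lemma euler_sums_shift: "euler_sums N f s \<Longrightarrow> euler_sums N (\<lambda>n. f (Suc n)) (f 0 - s)"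
proof (induction N arbitrary: f s)
  case 0
  then have "(\<lambda>n. (-1) ^ Suc n * f (Suc n)) sums (s - f 0)"
    by (subst sums_Suc_iff) simp
  then show ?case using sums_minus by fastforce
next
  case (Suc N)
  then show ?case
    using Suc.IH[of "fdiff f" "2 * s - f 0"]
    by (simp add: fdiff_def[abs_def] algebra_simps)
qed

section \<open>Existence of Euler sums, and their exchange with integrals and holomorphic
  limits\<close>

lemma euler_sums_exists:
  assumes "summable (\<lambda>n. norm ((fdiff ^^ N) f n))"
  shows "\<exists>s. euler_sums N f s"
  using assms
proof (induction N arbitrary: f)
  case 0
  then have "summable (\<lambda>n. (-1) ^ n * f n)"
    by (intro summable_norm_cancel[where f = "\<lambda>n. (-1) ^ n * f n"])
      (simp add: norm_mult norm_power)
  then show ?case by (auto simp: summable_def)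
next
  case (Suc N)
  then obtain s where "euler_sums N (fdiff f) s" by (auto simp: funpow_swap1)
  then have "euler_sums N (fdiff f) (2 * ((s + f 0) / 2) - f 0)"
    by (simp add: field_simps)
  then have "euler_sums (Suc N) f ((s + f 0) / 2)" by simp
  then show ?case by blast
qed

text \<open>Domination is asked of the \<open>N\<close>-th differences alone; each averaging step
  adds a single function \<open>\<phi> 0\<close>, for which integrability is enough. With Lebesgue
  measure this integrates the zeta function termwise in the Mellin-Barnes integral, with counting
  measure it exchanges the two summations.\<close>

lemma euler_sums_integral:
  assumes "\<And>n. integrable M (\<phi> n)"
    and "\<And>t. t \<in> space M \<Longrightarrow> euler_sums N (\<lambda>n. \<phi> n t) (s t)"
    and "summable (\<lambda>n. \<integral>t. norm ((fdiff ^^ N) (\<lambda>j. \<phi> j t) n) \<partial>M)"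
    and "\<And>t. t \<in> space M \<Longrightarrow> summable (\<lambda>n. norm ((fdiff ^^ N) (\<lambda>j. \<phi> j t) n))"
  shows "integrable M s \<and> euler_sums N (\<lambda>n. \<integral>t. \<phi> n t \<partial>M) (\<integral>t. s t \<partial>M)"
  using assms
proof (induction N arbitrary: \<phi> s)
  case 0
  let ?f = "\<lambda>n t. (-1) ^ n * \<phi> n t"
  have i: "integrable M (?f n)" for n using 0(1) by simp
  have su: "summable (\<lambda>n. norm (?f n t))" if "t \<in> space M" for t
    using 0(4)[OF that] by (simp add: norm_mult norm_power)
  have su': "summable (\<lambda>n. \<integral>t. norm (?f n t) \<partial>M)"
    using 0(3) by (simp add: norm_mult norm_power)
  have s: "s t = (\<Sum>n. ?f n t)" if "t \<in> space M" for t
    using 0(2)[OF that] sums_unique by simp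
  have "integrable M (\<lambda>t. \<Sum>n. ?f n t)"
    using integrable_suminf[OF i _ su'] su by auto
  then have "integrable M s"
    by (subst Bochner_Integration.integrable_cong[OF refl s])
  moreover have "(\<lambda>n. \<integral>t. ?f n t \<partial>M) sums (\<integral>t. (\<Sum>n. ?f n t) \<partial>M)"
    using sums_integral[OF i _ su'] su by auto
  then have "(\<lambda>n. \<integral>t. ?f n t \<partial>M) sums (\<integral>t. s t \<partial>M)"
    by (subst Bochner_Integration.integral_cong[OF refl s])
  ultimately show ?case by simp
next
  case (Suc N)
  let ?\<phi> = "\<lambda>n t. fdiff (\<lambda>j. \<phi> j t) n"
  let ?s = "\<lambda>t. 2 * s t - \<phi> 0 t"
  have *: "integrable M ?s \<and> euler_sums N (\<lambda>n. \<integral>t. ?\<phi> n t \<partial>M) (\<integral>t. ?s t \<partial>M)"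
  proof (rule Suc.IH)
    show "integrable M (?\<phi> n)" for n unfolding fdiff_def using Suc.prems(1) by simp
    show "euler_sums N (\<lambda>n. ?\<phi> n t) (?s t)" if "t \<in> space M" for t
      using Suc.prems(2)[OF that] by simp
  qed (use Suc.prems(3,4) in \<open>simp_all add: funpow_swap1\<close>)
  then have "integrable M (\<lambda>t. (?s t + \<phi> 0 t) / 2)"
    using Suc.prems(1) by (intro integrable_divide_zero Bochner_Integration.integrable_add) auto
  moreover have "(\<lambda>t. (?s t + \<phi> 0 t) / 2) = s" by auto
  ultimately have i: "integrable M s" by simp
  have "(\<integral>t. ?s t \<partial>M) = 2 * (\<integral>t. s t \<partial>M) - (\<integral>t. \<phi> 0 t \<partial>M)"
    using i Suc.prems(1) by simp
  moreover have "(\<lambda>n. \<integral>t. ?\<phi> n t \<partial>M) = fdiff (\<lambda>n. \<integral>t. \<phi> n t \<partial>M)"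
    using Suc.prems(1) by (auto simp: fdiff_def)
  ultimately show ?case using * i by simp
qed

text \<open>The Weierstrass test, applied to the \<open>N\<close>-th differences, where a uniform
  majorant exists although the original series may diverge. It provides the analytic continuation of
  zeta.\<close>

lemma euler_sums_holomorphic:
  assumes "open U"
    and "\<And>n. \<phi> n holomorphic_on U"
    and "\<And>w. w \<in> U \<Longrightarrow> euler_sums N (\<lambda>n. \<phi> n w) (s w)"
    and "\<forall>\<^sub>F n in sequentially. \<forall>w\<in>U. norm ((fdiff ^^ N) (\<lambda>j. \<phi> j w) n) \<le> B n"
    and "summable B"
  shows "s holomorphic_on U"
  using assms
proof (induction N arbitrary: \<phi> s)
  case 0
  let ?f = "\<lambda>n w. (-1) ^ n * \<phi> n w"
  have s: "s w = (\<Sum>n. ?f n w)" if "w \<in> U" for w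
    using 0(3)[OF that] sums_unique by simp
  have u: "uniform_limit U (\<lambda>n w. \<Sum>i<n. ?f i w) (\<lambda>w. \<Sum>i. ?f i w) sequentially"
    using 0(4,5) by (intro Weierstrass_m_test_ev) (simp_all add: norm_mult norm_power)
  have "(\<lambda>w. \<Sum>i. ?f i w) holomorphic_on U"
  proof (rule holomorphic_uniform_sequence[OF \<open>open U\<close>])
    show "(\<lambda>w. \<Sum>i<n. ?f i w) holomorphic_on U" for n
      using 0(2) by (intro holomorphic_intros)
    fix x assume "x \<in> U"
    then obtain d where "d > 0" "cball x d \<subseteq> U"
      using \<open>open U\<close> open_contains_cball by blast
    then show "\<exists>d>0. cball x d \<subseteq> U \<and>
        uniform_limit (cball x d) (\<lambda>n w. \<Sum>i<n. ?f i w) (\<lambda>w. \<Sum>i. ?f i w) sequentially"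
      using uniform_limit_on_subset[OF u] by blast
  qed
  then show ?case using holomorphic_cong[OF refl s] by simp
next
  case (Suc N)
  have "(\<lambda>w. 2 * s w - \<phi> 0 w) holomorphic_on U"
  proof (rule Suc.IH[where \<phi> = "\<lambda>n w. fdiff (\<lambda>j. \<phi> j w) n"])
    show "(\<lambda>w. fdiff (\<lambda>j. \<phi> j w) n) holomorphic_on U" for n
      unfolding fdiff_def using Suc.prems(2) by (intro holomorphic_intros)
    show "euler_sums N (\<lambda>n. fdiff (\<lambda>j. \<phi> j w) n) (2 * s w - \<phi> 0 w)" if "w \<in> U" for w
      using Suc.prems(3)[OF that] by simp
  qed (use Suc.prems in \<open>simp_all add: funpow_swap1\<close>)
  then have "(\<lambda>w. (2 * s w - \<phi> 0 w) + \<phi> 0 w) holomorphic_on U"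
    by (rule holomorphic_on_add[OF _ Suc.prems(2)])
  from holomorphic_on_mult[OF holomorphic_on_const[of "1 / 2"] this] show ?case by simp
qed

section \<open>Finite differences of holomorphic functions\<close>

text \<open>Mean value inequality along the unit segment from \<open>z\<close> to
  \<open>z + 1\<close>; the derivative there is at most \<open>B / \<rho>\<close> by Cauchy's
  inequality, because discs of radius \<open>\<rho>\<close> about points of the segment lie in
  \<open>cball z (\<rho> + 1)\<close>.\<close>

lemma difference_bound_ball:
  fixes f :: "complex \<Rightarrow> complex"
  assumes f: "f holomorphic_on ball y r"
    and B: "\<And>z. z \<in> ball y r \<Longrightarrow> norm (f z) \<le> B"
    and c: "cball z (\<rho> + 1) \<subseteq> ball y r" and "\<rho> > 0"
  shows "norm (f z - f (z + 1)) \<le> B / \<rho>"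
proof -
  have sub: "cball u \<rho> \<subseteq> ball y r" if "u \<in> closed_segment z (z + 1)" for u
  proof -
    have "norm (u - z) \<le> norm ((z + 1) - z)"
      using segment_bound(1)[OF that] by simp
    then have "dist z u \<le> 1" by (simp add: dist_norm norm_minus_commute)
    then have "cball u \<rho> \<subseteq> cball z (\<rho> + 1)"
      by (simp add: cball_subset_cball_iff dist_commute)
    then show ?thesis using c by blast
  qed
  have mem: "u \<in> ball y r" if "u \<in> closed_segment z (z + 1)" for u
    using subsetD[OF sub[OF that], of u] \<open>\<rho> > 0\<close> by simp
  have "norm (f (z + 1) - f z) \<le> B / \<rho> * norm ((z + 1) - z)"
  proof (rule field_differentiable_bound[where S = "closed_segment z (z + 1)" and f' = "deriv f"])
    fix u assume u: "u \<in> closed_segment z (z + 1)"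
    show "(f has_field_derivative deriv f u) (at u within closed_segment z (z + 1))"
      using holomorphic_derivI[OF f open_ball mem[OF u]] has_field_derivative_at_within by blast
    have "norm ((deriv ^^ 1) f u) \<le> fact 1 * B / \<rho> ^ 1"
    proof (rule Cauchy_inequality)
      show "f holomorphic_on ball u \<rho>"
        using f sub[OF u] ball_subset_cball holomorphic_on_subset by blast
      show "continuous_on (cball u \<rho>) f"
        using f sub[OF u] holomorphic_on_imp_continuous_on holomorphic_on_subset by blast
      show "norm (f v) \<le> B" if "norm (u - v) = \<rho>" for v
        using that sub[OF u] by (intro B) (auto simp: dist_norm)
    qed (use \<open>\<rho> > 0\<close> in auto)
    then show "norm (deriv f u) \<le> B / \<rho>" by simp
  qed auto
  then show ?thesis by (simp add: norm_minus_commute)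
qed

text \<open>Each difference shrinks the disc by \<open>\<rho> + 1\<close> and gains a factor
  \<open>1 / \<rho>\<close>.\<close>

lemma fdiff_pow_bound_ball:
  fixes f :: "complex \<Rightarrow> complex"
  assumes "f holomorphic_on ball y r"
    and "\<And>z. z \<in> ball y r \<Longrightarrow> norm (f z) \<le> B"
    and "real N * (\<rho> + 1) < r" and "\<rho> > 0" and y: "y = of_nat l + x"
  shows "norm ((fdiff ^^ N) (\<lambda>n. f (of_nat n + x)) l) \<le> B / \<rho> ^ N"
  using assms(1-3)
proof (induction N arbitrary: f B r)
  case 0
  then show ?case using y by simp
next
  case (Suc N)
  let ?g = "\<lambda>z. f z - f (z + 1)"
  let ?r = "r - (\<rho> + 1)"
  have eq: "fdiff (\<lambda>n. f (of_nat n + x)) = (\<lambda>n. ?g (of_nat n + x))"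
    by (rule ext) (simp add: fdiff_def algebra_simps)
  have sub: "cball z (\<rho> + 1) \<subseteq> ball y r" if "z \<in> ball y ?r" for z
    using that by (simp add: cball_subset_ball_iff dist_commute)
  have 1: "(\<lambda>z. z + 1) ` ball y ?r \<subseteq> ball y r"
  proof
    fix u assume "u \<in> (\<lambda>z. z + 1) ` ball y ?r"
    then obtain z where "z \<in> ball y ?r" "u = z + 1" by blast
    then show "u \<in> ball y r"
      using subsetD[OF sub, of z "z + 1"] \<open>\<rho> > 0\<close> by (simp add: dist_norm)
  qed
  have "(f \<circ> (\<lambda>z. z + 1)) holomorphic_on ball y ?r"
    using Suc.prems(1) 1 by (intro holomorphic_on_compose_gen[where t = "ball y r"] holomorphic_intros)
  then have hol: "?g holomorphic_on ball y ?r"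
    using holomorphic_on_subset[OF Suc.prems(1) subset_ball, of ?r] \<open>\<rho> > 0\<close>
    by (intro holomorphic_on_diff) (auto simp: o_def)
  have "norm ((fdiff ^^ N) (\<lambda>n. ?g (of_nat n + x)) l) \<le> (B / \<rho>) / \<rho> ^ N"
  proof (rule Suc.IH[OF hol])
    show "norm (f z - f (z + 1)) \<le> B / \<rho>" if "z \<in> ball y ?r" for z
      using difference_bound_ball[OF Suc.prems(1,2) sub[OF that] \<open>\<rho> > 0\<close>] .
    show "real N * (\<rho> + 1) < ?r" using Suc.prems(3) by (simp add: algebra_simps)
  qed
  then show ?case using eq by (simp add: funpow_swap1 divide_divide_eq_left)
qed

text \<open>Since the radius is proportional to \<open>norm y\<close>, so is the admissible
  \<open>\<rho>\<close>, and every difference gains a full power of \<open>norm y\<close>.\<close>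

lemma fdiff_pow_bound_cone:
  fixes f :: "complex \<Rightarrow> complex"
  assumes "f holomorphic_on ball y (\<delta> * norm y)"
    and "\<And>z. z \<in> ball y (\<delta> * norm y) \<Longrightarrow> norm (f z) \<le> B"
    and "\<delta> > 0" and "N > 0" and "norm y > 4 * real N / \<delta>" and y: "y = of_nat l + x"
  shows "norm ((fdiff ^^ N) (\<lambda>n. f (of_nat n + x)) l) \<le> B * (4 * real N / (\<delta> * norm y)) ^ N"
proof -
  \<comment> \<open>The size condition on \<open>y\<close> gives \<open>\<rho> > 1\<close>, hence
    \<open>real N * (\<rho> + 1) < 2 * real N * \<rho>\<close>, which is half of the available
    radius.\<close>
  define \<rho> where "\<rho> = \<delta> * norm y / (4 * real N)"
  have "\<delta> * norm y > 4 * real N" using assms(3,5) by (simp add: field_simps)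
  then have \<rho>: "\<rho> > 1" using \<open>N > 0\<close> by (simp add: \<rho>_def field_simps)
  have "real N * (\<rho> + 1) < real N * (4 * \<rho>)" using \<rho> \<open>N > 0\<close> by simp
  also have "\<dots> = \<delta> * norm y" using \<open>N > 0\<close> by (simp add: \<rho>_def)
  finally have "norm ((fdiff ^^ N) (\<lambda>n. f (of_nat n + x)) l) \<le> B / \<rho> ^ N"
    using \<rho> by (intro fdiff_pow_bound_ball[OF assms(1,2)] y) auto
  also have "\<dots> = B * (4 * real N / (\<delta> * norm y)) ^ N"
    by (simp add: \<rho>_def power_divide power_mult_distrib)
  finally show ?thesis .
qed

text \<open>A logarithmic coordinate \<open>v\<close> on the disc: \<open>norm (Ln (1 + u))\<close>
  is at most twice \<open>norm u\<close> for \<open>norm u < 1 / 2\<close>. Complex powers and the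
  integer power \<open>z ^ (2 * k)\<close> are both controlled through the smallness of
  \<open>v\<close>.\<close>

lemma cone_exp:
  fixes x \<delta> :: real and z :: complex
  assumes "x > 0" and "\<delta> \<le> 1 / 2" and "z \<in> ball (of_real x) (\<delta> * x)"
  obtains v where "z = of_real x * exp v" and "norm v \<le> 2 * \<delta>" and "Ln z = of_real (ln x) + v"
    and "Re z > 0" and "z \<noteq> 0" and "norm z \<le> 2 * x"
proof -
  define u where "u = z / of_real x - 1"
  have zu: "z = of_real x * (1 + u)" using \<open>x > 0\<close> by (simp add: u_def)
  have "norm (of_real x * u) < \<delta> * x"
    using assms(3) zu by (simp add: dist_norm norm_minus_commute algebra_simps)
  then have u: "norm u < \<delta>" using \<open>x > 0\<close> by (simp add: norm_mult)
  then have u2: "norm u < 1 / 2" using assms(2) by simp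
  have "1 + u \<noteq> 0"
  proof
    assume "1 + u = 0"
    then have "u = - 1" by (simp add: eq_neg_iff_add_eq_0 add.commute)
    then show False using u2 by simp
  qed
  have re: "Re u > - (1 / 2)" using u2 abs_Re_le_cmod[of u] by linarith
  show thesis
  proof (rule that[of "Ln (1 + u)"])
    show "z = of_real x * exp (Ln (1 + u))" using zu \<open>1 + u \<noteq> 0\<close> by simp
    show "norm (Ln (1 + u)) \<le> 2 * \<delta>" using norm_Ln_le[OF u2] u by simp
    show "Ln z = of_real (ln x) + Ln (1 + u)"
      using Ln_times_of_real[OF \<open>x > 0\<close> \<open>1 + u \<noteq> 0\<close>] Ln_of_real[OF \<open>x > 0\<close>] zu by simp
    show "Re z > 0" using zu re \<open>x > 0\<close> by simp
    then show "z \<noteq> 0" by auto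
    have "norm (1 + u) \<le> 2" using norm_triangle_ineq[of 1 u] u2 by simp
    then show "norm z \<le> 2 * x" using zu \<open>x > 0\<close> by (simp add: norm_mult)
  qed
qed

text \<open>The factor \<open>exp (2 * \<delta> * norm w)\<close> is the price of leaving the real
  axis. Keeping \<open>\<delta>\<close> free allows it to be made weaker than the decay of the
  reciprocal sine.\<close>

lemma norm_powr_cone:
  fixes x \<delta> :: real and z w :: complex
  assumes "x > 0" and "\<delta> \<le> 1 / 2" and "z \<in> ball (of_real x) (\<delta> * x)"
  shows "norm (z powr w) \<le> x powr Re w * exp (2 * \<delta> * norm w)"
proof -
  obtain v where v: "norm v \<le> 2 * \<delta>" "Ln z = of_real (ln x) + v" "z \<noteq> 0"
    using cone_exp[OF assms] by metis
  have "Re (w * Ln z) = Re w * ln x + Re (w * v)" using v(2) by (simp add: algebra_simps)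
  also have "Re (w * v) \<le> norm w * norm v" using complex_Re_le_cmod[of "w * v"] by (simp add: norm_mult)
  also have "\<dots> \<le> norm w * (2 * \<delta>)" by (intro mult_left_mono v) auto
  finally have "exp (Re (w * Ln z)) \<le> exp (Re w * ln x + 2 * \<delta> * norm w)" by (simp add: algebra_simps)
  then show ?thesis using v(3) assms(1) by (simp add: powr_def exp_add)
qed

lemma of_nat_add_of_real: "of_nat n + of_real a = (of_real (real n + a) :: complex)"
  by simp

lemma norm_of_nat_add_of_real: "a > 0 \<Longrightarrow> norm (of_nat n + of_real a :: complex) = real n + a"
  unfolding of_nat_add_of_real norm_of_real by simp

lemma fdiff_pow_cone_real:
  fixes f :: "complex \<Rightarrow> complex" and a \<delta> :: real
  assumes "f holomorphic_on ball (of_real (real n + a)) (\<delta> * (real n + a))"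
    and "\<delta> > 0" and "\<delta> \<le> 1 / 2" and "a > 0" and "N > 0"
    and "real n > 4 * real N / \<delta>"
    and "\<And>z. z \<in> ball (of_real (real n + a)) (\<delta> * (real n + a)) \<Longrightarrow> norm (f z) \<le> B"
  shows "norm ((fdiff ^^ N) (\<lambda>n. f (of_nat n + of_real a)) n)
      \<le> B * (4 * real N / \<delta>) ^ N * (real n + a) powr (- real N)"
proof -
  let ?x = "real n + a"
  have x: "?x > 0" using \<open>a > 0\<close> by simp
  have "norm ((fdiff ^^ N) (\<lambda>n. f (of_nat n + of_real a)) n)
      \<le> B * (4 * real N / (\<delta> * norm (complex_of_real ?x))) ^ N"
    using assms x
    by (intro fdiff_pow_bound_cone) (auto simp: norm_of_nat_add_of_real simp flip: of_nat_add_of_real)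
  also have "\<dots> = B * (4 * real N / \<delta>) ^ N * ?x powr (- real N)"
    using x
    by (simp only: norm_of_real abs_of_pos powr_minus powr_realpow power_divide power_mult_distrib)
      (simp add: divide_inverse)
  finally show ?thesis .
qed

lemma summable_shifted_powr:
  fixes a p :: real
  assumes "a > 0" and "p < - 1"
  shows "summable (\<lambda>n. (real n + a) powr p)"
proof (rule summable_comparison_test_ev)
  show "summable (\<lambda>n. real n powr p)" using assms(2) by (simp add: summable_real_powr_iff)
  show "\<forall>\<^sub>F n in sequentially. norm ((real n + a) powr p) \<le> real n powr p"
    using eventually_gt_at_top[of 0]
    by eventually_elim (use assms in \<open>auto intro!: powr_mono2'\<close>)
qed

lemma fdiff_pow_powr_bound:
  fixes a \<delta> :: real and w :: complex
  assumes "\<delta> > 0" and "\<delta> \<le> 1 / 2" and "a > 0" and "N > 0" and "real n > 4 * real N / \<delta>"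
  shows "norm ((fdiff ^^ N) (\<lambda>n. (of_nat n + of_real a) powr w) n)
      \<le> exp (2 * \<delta> * norm w) * (4 * real N / \<delta>) ^ N * (real n + a) powr (Re w - real N)"
proof -
  have "norm ((fdiff ^^ N) (\<lambda>n. (of_nat n + of_real a) powr w) n)
      \<le> ((real n + a) powr Re w * exp (2 * \<delta> * norm w)) * (4 * real N / \<delta>) ^ N
          * (real n + a) powr (- real N)"
  proof (rule fdiff_pow_cone_real[where f = "\<lambda>z. z powr w"])
    have x: "real n + a > 0" using \<open>a > 0\<close> by simp
    have "z \<notin> \<real>\<^sub>\<le>\<^sub>0" if "z \<in> ball (of_real (real n + a)) (\<delta> * (real n + a))" for z :: complex
    proof -
      have "Re z > 0" by (rule cone_exp[OF x assms(2) that])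
      then show ?thesis by (auto simp: complex_nonpos_Reals_iff)
    qed
    then show "(\<lambda>z. z powr w) holomorphic_on ball (of_real (real n + a)) (\<delta> * (real n + a))"
      by (intro holomorphic_on_powr holomorphic_on_ident holomorphic_on_const)
    show "norm (z powr w) \<le> (real n + a) powr Re w * exp (2 * \<delta> * norm w)"
      if "z \<in> ball (of_real (real n + a)) (\<delta> * (real n + a))" for z
      using norm_powr_cone[OF _ assms(2) that] \<open>a > 0\<close> by simp
  qed (fact assms)+
  also have "\<dots> = exp (2 * \<delta> * norm w) * (4 * real N / \<delta>) ^ N * (real n + a) powr (Re w - real N)"
    using \<open>a > 0\<close> by (simp add: powr_diff powr_minus field_simps)
  finally show ?thesis .
qed

lemma euler_sums_powr_exists:
  fixes a :: real and w :: complex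
  assumes "a > 0" and "N > 0" and "real N > 1 + Re w"
  shows "\<exists>s. euler_sums N (\<lambda>n. (of_nat n + of_real a) powr w) s"
proof (rule euler_sums_exists, rule summable_comparison_test_ev)
  \<comment> \<open>The constant belongs to the widest cone allowed,
    \<open>\<delta> = 1 / 2\<close>; for a fixed exponent \<open>w\<close> the size of
    \<open>exp (2 * \<delta> * norm w)\<close> does not matter.\<close>
  let ?C = "exp (norm w) * (8 * real N) ^ N"
  show "summable (\<lambda>n. ?C * (real n + a) powr (Re w - real N))"
    using assms by (intro summable_mult summable_shifted_powr) auto
  show "\<forall>\<^sub>F n in sequentially. norm (norm ((fdiff ^^ N) (\<lambda>n. (of_nat n + of_real a) powr w) n))
      \<le> ?C * (real n + a) powr (Re w - real N)"
    using eventually_gt_at_top[of "nat \<lceil>8 * real N\<rceil>"]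
  proof eventually_elim
    case (elim n)
    then have "real n > 8 * real N" by linarith
    then have "real n > 4 * real N / (1 / 2)" by simp
    from fdiff_pow_powr_bound[OF _ _ assms(1,2) this, of w] show ?case by simp
  qed
qed

section \<open>The alternating zeta function and Euler polynomials as Euler sums\<close>

lemma powr_tendsto_zero:
  fixes w :: complex and a :: real
  assumes "Re w < 0" and "a > 0"
  shows "(\<lambda>n. (of_nat n + of_real a) powr w) \<longlonglongrightarrow> 0"
proof (rule tendsto_norm_zero_cancel)
  have "norm ((of_nat n + of_real a) powr w) = (real n + a) powr Re w" for n
    unfolding of_nat_add_of_real using \<open>a > 0\<close> by (subst norm_powr_real_powr) auto
  moreover have "(\<lambda>n. (real n + a) powr Re w) \<longlonglongrightarrow> 0"
    using filterlim_tendsto_add_at_top[OF tendsto_const[of a] filterlim_real_sequentially]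
    by (intro tendsto_neg_powr assms(1)) (simp add: add.commute)
  ultimately show "(\<lambda>n. norm ((of_nat n + of_real a) powr w)) \<longlonglongrightarrow> 0" by simp
qed

text \<open>The Euler sums form an entire function of \<open>w\<close> that agrees with the
  convergent series for \<open>Re w > 0\<close>. By the identity theorem it is the only such
  function, so the description in \<open>alt_hurwitz_zeta\<close> has a unique solution and denotes
  it.\<close>

lemma euler_sums_alt_hurwitz_zeta:
  fixes a :: real and w :: complex
  assumes "a > 0" and "N > 0" and "real N > 1 - Re w"
  shows "euler_sums N (\<lambda>n. (of_nat n + of_real a) powr (- w)) (alt_hurwitz_zeta w (of_real a))"
proof -
  \<comment> \<open>\<open>K w\<close> is one number of averaging steps that is certainly enough for
    \<open>w\<close>. Any other admissible number gives the same value by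
    \<open>euler_sums_mono\<close> and \<open>euler_sums_unique\<close>.\<close>
  define K where "K w = nat \<lceil>norm w\<rceil> + 2" for w :: complex
  define Z where "Z w = (SOME s. euler_sums (K w) (\<lambda>n. (of_nat n + of_real a) powr (- w)) s)" for w
  have K: "euler_sums (K w) (\<lambda>n. (of_nat n + of_real a) powr (- w)) (Z w)" for w
  proof -
    have "norm w \<le> real (nat \<lceil>norm w\<rceil>)" by linarith
    then have "real (K w) > 1 + Re (- w)" "K w > 0"
      using abs_Re_le_cmod[of w] unfolding K_def by (simp_all, linarith)
    from euler_sums_powr_exists[OF \<open>a > 0\<close> this(2,1)] show ?thesis
      unfolding Z_def by (rule someI_ex)
  qed
  have Z: "euler_sums N (\<lambda>n. (of_nat n + of_real a) powr (- w)) (Z w)"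
    if N: "N > 0" "real N > 1 - Re w" for N w
  proof -
    obtain s where s: "euler_sums N (\<lambda>n. (of_nat n + of_real a) powr (- w)) s"
      using euler_sums_powr_exists[of a N "- w"] N \<open>a > 0\<close> by auto
    have "s = Z w"
      using euler_sums_mono[OF s, of "max N (K w)"] euler_sums_mono[OF K, of w "max N (K w)"]
        euler_sums_unique by simp
    then show ?thesis using s by simp
  qed
  have hol: "Z holomorphic_on ball 0 R" if "R > 0" for R
  proof -
    \<comment> \<open>One \<open>N\<close> has to serve the whole ball: \<open>N \<ge> R + 2\<close>
      keeps the exponent \<open>R - real N\<close> of the common majorant at most -2.\<close>
    define N where "N = nat \<lceil>R\<rceil> + 2"
    have N: "real N \<ge> R + 2" "N > 0" by (simp_all add: N_def) linarith
    show ?thesis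
    proof (rule euler_sums_holomorphic[where N = N])
      show "(\<lambda>w. (of_nat n + of_real a) powr (- w)) holomorphic_on ball 0 R" for n :: nat
        by (intro holomorphic_intros)
      show "euler_sums N (\<lambda>n. (of_nat n + of_real a) powr (- w)) (Z w)" if "w \<in> ball 0 R" for w
        using that N abs_Re_le_cmod[of w] by (intro Z) auto
      let ?B = "\<lambda>n. exp R * (8 * real N) ^ N * (real n + a) powr (R - real N)"
      show "summable ?B"
        using N \<open>a > 0\<close> by (intro summable_mult summable_shifted_powr) auto
      show "\<forall>\<^sub>F n in sequentially. \<forall>w\<in>ball 0 R.
          norm ((fdiff ^^ N) (\<lambda>j. (of_nat j + of_real a) powr (- w)) n) \<le> ?B n"
        using eventually_gt_at_top[of "nat \<lceil>8 * real N\<rceil>"]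
      proof eventually_elim
        case (elim n)
        then have "real n > 8 * real N" by linarith
        then have n: "real n > 4 * real N / (1 / 2)" by simp
        then have n1: "real n + a \<ge> 1" using \<open>a > 0\<close> N \<open>R > 0\<close> by simp
        show ?case
        proof
          fix w assume w: "w \<in> ball (0 :: complex) R"
          from fdiff_pow_powr_bound[OF _ _ \<open>a > 0\<close> N(2) n, of "- w"]
          have "norm ((fdiff ^^ N) (\<lambda>n. (of_nat n + of_real a) powr (- w)) n)
              \<le> exp (norm w) * (8 * real N) ^ N * (real n + a) powr (- Re w - real N)" by simp
          also have "\<dots> \<le> ?B n"
            using w abs_Re_le_cmod[of w] n1 by (intro mult_mono powr_mono) auto
          finally show "norm ((fdiff ^^ N) (\<lambda>n. (of_nat n + of_real a) powr (- w)) n) \<le> ?B n" .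
        qed
      qed
    qed auto
  qed
  have entire: "Z holomorphic_on UNIV"
    unfolding holomorphic_on_def
  proof
    fix w :: complex
    have "norm w + 1 > 0" by (simp add: add_nonneg_pos)
    from hol[OF this] have "Z field_differentiable (at w)"
      by (rule holomorphic_on_imp_differentiable_at) auto
    then show "Z field_differentiable (at w within UNIV)" by simp
  qed
  have eq: "(\<lambda>n. (-1) ^ n / (of_nat n + of_real a) powr w)
      = (\<lambda>n. (-1) ^ n * (of_nat n + of_real a) powr (- w))" for w :: complex
    by (simp add: powr_minus divide_inverse)
  \<comment> \<open>For \<open>Re w > 0\<close> one averaging step suffices and the terms tend to 0,
    so that step can be undone.\<close>
  have sums: "(\<lambda>n. (-1) ^ n / (of_nat n + of_real a) powr w) sums Z w" if "Re w > 0" for w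
    using euler_sums_null[OF powr_tendsto_zero Z[of 1 w]] that \<open>a > 0\<close> unfolding eq by simp
  have "(THE f. f holomorphic_on UNIV \<and>
       (\<forall>w. Re w > 0 \<longrightarrow> (\<lambda>n. (-1) ^ n / (of_nat n + of_real a) powr w) sums f w)) = Z"
  proof (rule the_equality)
    fix f assume f: "f holomorphic_on UNIV \<and>
       (\<forall>w. Re w > 0 \<longrightarrow> (\<lambda>n. (-1) ^ n / (of_nat n + of_real a) powr w) sums f w)"
    show "f = Z"
    proof
      fix w
      show "f w = Z w"
      proof (rule analytic_continuation_open[where f = f and g = Z and s = "{w. Re w > 0}" and s' = UNIV])
        show "open {w. Re w > 0}" by (rule open_halfspace_Re_gt)
        show "{w. Re w > 0} \<noteq> {}" by (auto intro: exI[of _ 1])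
        show "f z = Z z" if "z \<in> {w. Re w > 0}" for z
          using f sums[of z] that sums_unique2 by blast
      qed (use f entire in auto)
    qed
  qed (use entire sums in auto)
  then have "alt_hurwitz_zeta w (of_real a) = Z w" by (simp add: alt_hurwitz_zeta_def)
  then show ?thesis using Z assms by simp
qed

lemma euler_poly_altdef:
  "euler_poly n x = (\<Sum>i\<le>n. 2 * fact n * fps_nth (inverse (fps_exp 1 + 1)) (n - i) / fact i * x ^ i)"
proof -
  have "fps_nth (fps_const 2 * fps_exp x / (fps_exp 1 + 1)) n
      = (\<Sum>i\<le>n. 2 * (x ^ i / fact i) * fps_nth (inverse (fps_exp 1 + 1)) (n - i))"
    by (subst fps_divide_unit, simp, subst fps_mult_nth)
      (simp only: fps_mult_left_const_nth fps_exp_nth atLeast0AtMost of_nat_fact)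
  then show ?thesis by (simp add: euler_poly_def sum_distrib_left mult_ac)
qed

text \<open>Replacing \<open>x\<close> by \<open>x + 1\<close> multiplies the generating function by
  \<open>exp t\<close>, so the two generating functions add up to one in which the denominator
  cancels.\<close>

lemma euler_poly_plus_one: "euler_poly n (x + 1) + euler_poly n x = 2 * x ^ n"
proof -
  have "fps_exp (x + 1) + fps_exp x = fps_exp x * (fps_exp 1 + 1)"
    by (simp add: fps_exp_add_mult algebra_simps)
  moreover have "(fps_exp 1 + 1 :: complex fps) * inverse (fps_exp 1 + 1) = 1"
    by (rule inverse_mult_eq_1') simp
  ultimately have "(fps_exp (x + 1) + fps_exp x) * inverse (fps_exp 1 + 1) = fps_exp x"
    by (simp only: mult.assoc mult_1_right)
  then have "fps_const 2 * ((fps_exp (x + 1) + fps_exp x) * inverse (fps_exp 1 + 1))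
      = fps_const 2 * fps_exp x" by simp
  then have "fps_const 2 * fps_exp (x + 1) / (fps_exp 1 + 1) + fps_const 2 * fps_exp x / (fps_exp 1 + 1)
      = fps_const 2 * fps_exp x"
    by (simp add: fps_divide_unit distrib_left distrib_right mult.assoc)
  from arg_cong[OF this, of "\<lambda>f. fact n * fps_nth f n"] show ?thesis
    by (simp only: euler_poly_def fps_add_nth distrib_left fps_mult_left_const_nth fps_exp_nth) simp
qed

lemma of_nat_add_of_real_nonzero: "a > 0 \<Longrightarrow> of_nat n + of_real a \<noteq> (0 :: complex)"
  unfolding of_nat_add_of_real of_real_eq_0_iff by simp

lemma euler_sums_power_exists:
  fixes a :: real
  assumes "a > 0" and "N \<ge> i + 2"
  shows "\<exists>s. euler_sums N (\<lambda>l. (of_nat l + of_real a) ^ i) s"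
proof -
  have "(\<lambda>l. (of_nat l + of_real a) powr of_nat i) = (\<lambda>l. (of_nat l + of_real a :: complex) ^ i)"
    using of_nat_add_of_real_nonzero[OF \<open>a > 0\<close>] by (intro ext powr_nat') simp
  then show ?thesis using euler_sums_powr_exists[of a N "of_nat i"] assms by simp
qed

text \<open>Let \<open>t\<close> be the Euler sum of \<open>l \<mapsto> E_i(l + a)\<close>. The
  shifted sequence has Euler sum \<open>E_i(a) - t\<close>, so the unknown \<open>t\<close> cancels
  when the two are added, while by \<open>euler_poly_plus_one\<close> the sequences add up to
  \<open>2 * (l + a) ^ i\<close>.\<close>

lemma euler_sums_euler_poly:
  fixes a :: real
  assumes "a > 0" and "N \<ge> i + 2"
  shows "euler_sums N (\<lambda>l. (of_nat l + of_real a) ^ i) (euler_poly i (of_real a) / 2)"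
proof -
  let ?g = "\<lambda>l. euler_poly i (of_nat l + of_real a)"
  have "\<exists>s. euler_sums N (\<lambda>l. (of_nat l + of_real a) ^ j) s" if "j \<le> i" for j
    using euler_sums_power_exists[OF \<open>a > 0\<close>] assms(2) that by simp
  then obtain s where "\<And>j. j \<le> i \<Longrightarrow> euler_sums N (\<lambda>l. (of_nat l + of_real a) ^ j) (s j)"
    by metis
  then have "euler_sums N (\<lambda>l. \<Sum>j\<le>i. 2 * fact i * fps_nth (inverse (fps_exp 1 + 1)) (i - j) / fact j
        * (of_nat l + of_real a) ^ j)
      (\<Sum>j\<le>i. 2 * fact i * fps_nth (inverse (fps_exp 1 + 1)) (i - j) / fact j * s j)"
    by (intro euler_sums_sum euler_sums_cmult) auto
  then obtain t where t: "euler_sums N ?g t" unfolding euler_poly_altdef by blast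
  from euler_sums_add[OF this euler_sums_shift[OF this]]
  have "euler_sums N (\<lambda>l. ?g l + ?g (Suc l)) (?g 0)" by simp
  moreover have "(\<lambda>l. ?g l + ?g (Suc l)) = (\<lambda>l. 2 * (of_nat l + of_real a) ^ i)"
  proof
    fix l
    show "?g l + ?g (Suc l) = 2 * (of_nat l + of_real a) ^ i"
      using euler_poly_plus_one[of i "of_nat l + of_real a"] by (simp add: add_ac)
  qed
  ultimately have "euler_sums N (\<lambda>l. 1 / 2 * (2 * (of_nat l + of_real a) ^ i)) (1 / 2 * ?g 0)"
    by (intro euler_sums_cmult) simp
  then show ?thesis by simp
qed

section \<open>Interchanging the summations\<close>

text \<open>With \<open>z = x * exp v\<close> one has \<open>norm (2 * k * v) \<le> 1\<close>, so
  the argument of \<open>z ^ (2 * k)\<close> stays within \<open>pi / 2\<close> and its real part is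
  nonnegative. Adding \<open>y ^ (2 * k)\<close> therefore leaves a modulus of at least
  \<open>y ^ (2 * k)\<close>, uniformly in \<open>x\<close>.\<close>

lemma rational_cone:
  fixes x y :: real and z :: complex
  assumes "x > 0" and "y > 0" and "k > 0" and "z \<in> ball (of_real x) (1 / (4 * real k) * x)"
  shows "z ^ (2 * k) + of_real (y ^ (2 * k)) \<noteq> 0"
    and "norm (z ^ p / (z ^ (2 * k) + of_real (y ^ (2 * k)))) \<le> (2 * x) ^ p / y ^ (2 * k)"
proof -
  have "1 / (4 * real k) \<le> 1 / 2" using \<open>k > 0\<close> by (simp add: field_simps)
  from cone_exp[OF assms(1) this assms(4)]
  obtain v where v: "z = of_real x * exp v" "norm v \<le> 2 * (1 / (4 * real k))" "norm z \<le> 2 * x" .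
  define w where "w = of_nat (2 * k) * v"
  have "norm w \<le> 1" using v(2) \<open>k > 0\<close> by (simp add: w_def norm_mult field_simps)
  then have "\<bar>Im w\<bar> \<le> 1" using abs_Im_le_cmod order_trans by blast
  then have "cos (Im w) \<ge> 0"
    using pi_ge_two by (intro cos_ge_zero) linarith+
  moreover have "z ^ (2 * k) = of_real (x ^ (2 * k)) * exp w"
    unfolding v(1) w_def exp_of_nat_mult by (simp add: power_mult_distrib)
  ultimately have "Re (z ^ (2 * k)) \<ge> 0" by (simp add: Re_exp)
  then have "Re (z ^ (2 * k) + of_real (y ^ (2 * k))) \<ge> y ^ (2 * k)" by simp
  then have d: "norm (z ^ (2 * k) + of_real (y ^ (2 * k))) \<ge> y ^ (2 * k)"
    using complex_Re_le_cmod order_trans by blast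
  moreover have y: "y ^ (2 * k) > 0" using \<open>y > 0\<close> by simp
  ultimately show "z ^ (2 * k) + of_real (y ^ (2 * k)) \<noteq> 0" by (metis norm_zero not_less)
  show "norm (z ^ p / (z ^ (2 * k) + of_real (y ^ (2 * k)))) \<le> (2 * x) ^ p / y ^ (2 * k)"
    unfolding norm_divide norm_power using d y v(3) \<open>x > 0\<close> by (intro frac_le power_mono) auto
qed

text \<open>Dependence on \<open>l\<close> and on \<open>y\<close> separates in this bound, which is
  what makes the interchange possible. The constant \<open>16 * real k * real N\<close> is
  \<open>4 * real N / \<delta>\<close> for \<open>\<delta> = 1 / (4 * real k)\<close>.\<close>

lemma fdiff_pow_rational_bound:
  fixes a y :: real
  assumes "a > 0" and "y > 0" and "k > 0" and "N > 0" and "real n > 16 * real k * real N"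
  shows "norm ((fdiff ^^ N) (\<lambda>l. (of_nat l + of_real a) ^ p
        / ((of_nat l + of_real a) ^ (2 * k) + of_real (y ^ (2 * k)))) n)
      \<le> 2 ^ p * (16 * real k * real N) ^ N * (real n + a) powr (real p - real N) / y ^ (2 * k)"
proof -
  let ?f = "\<lambda>z. z ^ p / (z ^ (2 * k) + complex_of_real (y ^ (2 * k)))"
  have x: "real n + a > 0" using \<open>a > 0\<close> by simp
  have "norm ((fdiff ^^ N) (\<lambda>l. ?f (of_nat l + of_real a)) n)
      \<le> (2 * (real n + a)) ^ p / y ^ (2 * k) * (4 * real N / (1 / (4 * real k))) ^ N
        * (real n + a) powr (- real N)"
  proof (rule fdiff_pow_cone_real)
    show "?f holomorphic_on ball (of_real (real n + a)) (1 / (4 * real k) * (real n + a))"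
      using rational_cone(1)[OF x \<open>y > 0\<close> \<open>k > 0\<close>] by (intro holomorphic_intros) blast
    show "norm (?f z) \<le> (2 * (real n + a)) ^ p / y ^ (2 * k)"
      if "z \<in> ball (of_real (real n + a)) (1 / (4 * real k) * (real n + a))" for z
      using rational_cone(2)[OF x \<open>y > 0\<close> \<open>k > 0\<close> that] .
    show "1 / (4 * real k) > 0" "1 / (4 * real k) \<le> 1 / 2"
      using \<open>k > 0\<close> by (simp_all add: field_simps)
    show "real n > 4 * real N / (1 / (4 * real k))" using assms(5) by (simp add: mult_ac)
  qed (fact assms)+
  also have "\<dots> = 2 ^ p * (16 * real k * real N) ^ N * (real n + a) powr (real p - real N) / y ^ (2 * k)"
  proof -
    have 1: "4 * real N / (1 / (4 * real k)) = 16 * real k * real N" by simp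
    have 2: "(real n + a) powr (real p - real N) = (real n + a) ^ p * (real n + a) powr (- real N)"
      using x by (simp add: powr_diff powr_minus powr_realpow divide_inverse)
    have 3: "A * B / Y * C * D = A * C * (B * D) / Y" for A B C D Y :: real by simp
    show ?thesis unfolding 1 2 power_mult_distrib[of 2] by (rule 3)
  qed
  finally show ?thesis .
qed

text \<open>The sum over \<open>n\<close> is an integral for counting measure, and
  \<open>euler_sums_integral\<close> acts as a Fubini theorem. The \<open>N\<close>-th differences
  in \<open>l\<close> are bounded by a product: \<open>N \<ge> p + 2\<close> makes the exponent of
  \<open>l + a\<close> at most -2, while the weight \<open>1 / (n + b)\<close> and the denominator
  together decay in \<open>n\<close> with exponent \<open>- 1 - 2 * k\<close>. Integrability of the
  result gives convergence of the outer series.\<close>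

lemma euler_sums_sum_interchange:
  fixes a b \<sigma> :: real and s :: "nat \<Rightarrow> complex"
  assumes "a > 0" and "b > 0" and "\<sigma> > 0" and "k > 0" and "N \<ge> p + 2"
    and s: "\<And>n. euler_sums N (\<lambda>l. (of_nat l + of_real a) ^ p
        / ((of_nat l + of_real a) ^ (2 * k) + of_real ((\<sigma> * (real n + b)) ^ (2 * k)))) (s n)"
  shows "\<exists>S. (\<lambda>n. (-1) ^ n / of_real (real n + b) * s n) sums S \<and>
    euler_sums N (\<lambda>l. (of_nat l + of_real a) ^ p * (\<Sum>n. (-1) ^ n / of_real (real n + b)
        / ((of_nat l + of_real a) ^ (2 * k) + of_real ((\<sigma> * (real n + b)) ^ (2 * k))))) S"
proof -
  define y where "y n = \<sigma> * (real n + b)" for n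
  have y: "y n > 0" for n using assms by (simp add: y_def)
  define c where "c n = (-1) ^ n / complex_of_real (real n + b)" for n
  have nc: "norm (c n) = 1 / (real n + b)" for n
    using \<open>b > 0\<close> unfolding c_def norm_divide norm_of_real by (simp add: norm_power)
  define g where "g n l = (of_nat l + of_real a) ^ p / ((of_nat l + of_real a) ^ (2 * k) + complex_of_real (y n ^ (2 * k)))" for n l
  let ?\<phi> = "\<lambda>l n. c n * g n l"
  have w: "summable (\<lambda>n. 1 / (real n + b) / y n ^ (2 * k))" (is "summable ?w")
  proof -
    have "summable (\<lambda>n. (1 / \<sigma> ^ (2 * k)) * (real n + b) powr (- 1 - real (2 * k)))"
      using assms by (intro summable_mult summable_shifted_powr) auto
    moreover have "(1 / \<sigma> ^ (2 * k)) * (real n + b) powr (- 1 - real (2 * k)) = ?w n" for n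
    proof -
      have "real n + b > 0" using \<open>b > 0\<close> by simp
      then show ?thesis
        by (simp only: powr_diff powr_minus powr_realpow y_def power_mult_distrib[of \<sigma>] powr_one_gt_zero_iff)
          (simp add: powr_minus divide_inverse mult_ac)
    qed
    ultimately show ?thesis by (simp only:)
  qed
  have int: "integrable (count_space UNIV) (?\<phi> l)" for l
  proof -
    have "summable (\<lambda>n. norm (?\<phi> l n))"
    proof (rule summable_comparison_test')
      let ?C = "(real l + a) ^ p"
      show "summable (\<lambda>n. ?C * ?w n)" by (intro summable_mult w)
      fix n
      have "norm (g n l) \<le> ?C / y n ^ (2 * k)"
      proof -
        have "g n l = of_real ((real l + a) ^ p / ((real l + a) ^ (2 * k) + y n ^ (2 * k)))"
          by (simp add: g_def)
        also have "norm \<dots> = (real l + a) ^ p / ((real l + a) ^ (2 * k) + y n ^ (2 * k))"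
          using \<open>a > 0\<close> y[of n] by (simp only: norm_of_real) simp
        also have "\<dots> \<le> ?C / y n ^ (2 * k)"
          using \<open>a > 0\<close> y[of n] by (intro frac_le) auto
        finally show ?thesis .
      qed
      then have "norm (?\<phi> l n) \<le> 1 / (real n + b) * (?C / y n ^ (2 * k))"
        unfolding norm_mult nc using \<open>b > 0\<close> by (intro mult_left_mono) auto
      then show "norm (norm (?\<phi> l n)) \<le> ?C * ?w n" by (simp add: mult_ac)
    qed
    then show ?thesis by (simp add: integrable_count_space_nat_iff)
  qed
  let ?C = "2 ^ p * (16 * real k * real N) ^ N"
  let ?B = "\<lambda>l. ?C * (real l + a) powr (real p - real N)"
  have fd: "(fdiff ^^ N) (\<lambda>l. ?\<phi> l n) l = c n * (fdiff ^^ N) (g n) l" for n l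
    using fdiff_pow_cmult[of N "c n" "g n"] by simp
  have bound: "norm ((fdiff ^^ N) (\<lambda>l. ?\<phi> l n) l) \<le> ?B l * ?w n"
    if "real l > 16 * real k * real N" for n l
  proof -
    have "norm ((fdiff ^^ N) (g n) l) \<le> ?B l / y n ^ (2 * k)"
      unfolding g_def using fdiff_pow_rational_bound[OF \<open>a > 0\<close> y \<open>k > 0\<close> _ that] assms(5) by simp
    then have "1 / (real n + b) * norm ((fdiff ^^ N) (g n) l) \<le> 1 / (real n + b) * (?B l / y n ^ (2 * k))"
      using \<open>b > 0\<close> by (intro mult_left_mono) auto
    then show ?thesis unfolding fd norm_mult nc by (simp add: mult_ac)
  qed
  have sB: "summable ?B" using assms by (intro summable_mult summable_shifted_powr) auto
  have large: "\<forall>\<^sub>F l in sequentially. real l > 16 * real k * real N"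
    using eventually_gt_at_top[of "nat \<lceil>16 * real k * real N\<rceil>"] by eventually_elim linarith
  have "integrable (count_space UNIV) (\<lambda>n. c n * s n) \<and>
      euler_sums N (\<lambda>l. \<integral>n. ?\<phi> l n \<partial>count_space UNIV) (\<integral>n. c n * s n \<partial>count_space UNIV)"
  proof (rule euler_sums_integral)
    show "euler_sums N (\<lambda>l. c n * g n l) (c n * s n)" for n
      using s[of n] by (intro euler_sums_cmult) (simp add: g_def y_def)
    show "summable (\<lambda>l. norm ((fdiff ^^ N) (\<lambda>l. ?\<phi> l n) l))" for n
    proof (rule summable_comparison_test_ev)
      show "summable (\<lambda>l. ?B l * ?w n)" by (intro summable_mult2 sB)
      show "\<forall>\<^sub>F l in sequentially. norm (norm ((fdiff ^^ N) (\<lambda>l. ?\<phi> l n) l)) \<le> ?B l * ?w n"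
        using large by eventually_elim (use bound in simp)
    qed
    show "summable (\<lambda>l. \<integral>n. norm ((fdiff ^^ N) (\<lambda>l. ?\<phi> l n) l) \<partial>count_space UNIV)"
    proof (rule summable_comparison_test_ev)
      let ?W = "\<integral>n. ?w n \<partial>count_space UNIV"
      have iw: "integrable (count_space UNIV) ?w"
        unfolding integrable_count_space_nat_iff using w y \<open>b > 0\<close> by (simp add: less_imp_le abs_mult)
      show "summable (\<lambda>l. ?B l * ?W)" by (intro summable_mult2 sB)
      show "\<forall>\<^sub>F l in sequentially. norm (\<integral>n. norm ((fdiff ^^ N) (\<lambda>l. ?\<phi> l n) l) \<partial>count_space UNIV) \<le> ?B l * ?W"
        using large
      proof eventually_elim
        case (elim l)
        have "(\<integral>n. norm ((fdiff ^^ N) (\<lambda>l. ?\<phi> l n) l) \<partial>count_space UNIV)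
            \<le> (\<integral>n. ?B l * ?w n \<partial>count_space UNIV)"
        proof (rule integral_mono')
          show "integrable (count_space UNIV) (\<lambda>n. ?B l * ?w n)" by (intro integrable_mult_right iw)
          show "norm ((fdiff ^^ N) (\<lambda>l. ?\<phi> l n) l) \<le> ?B l * ?w n" for n by (rule bound[OF elim])
          then show "0 \<le> ?B l * ?w n" for n by (meson norm_ge_zero order_trans)
        qed
        also have "\<dots> = ?B l * ?W" by (rule integral_mult_right_zero)
        finally show ?case by simp
      qed
    qed
  qed (fact int)
  then have 1: "integrable (count_space UNIV) (\<lambda>n. c n * s n)"
    and 2: "euler_sums N (\<lambda>l. \<integral>n. ?\<phi> l n \<partial>count_space UNIV) (\<integral>n. c n * s n \<partial>count_space UNIV)"
    by blast+
  have "(\<integral>n. ?\<phi> l n \<partial>count_space UNIV) = (of_nat l + of_real a) ^ p * (\<Sum>n. c n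
        / ((of_nat l + of_real a) ^ (2 * k) + of_real (y n ^ (2 * k))))" for l
  proof -
    have *: "(\<lambda>n. (of_nat l + of_real a) ^ p * (c n / ((of_nat l + of_real a) ^ (2 * k) + of_real (y n ^ (2 * k)))))
        sums (\<integral>n. ?\<phi> l n \<partial>count_space UNIV)"
      using sums_integral_count_space_nat[OF int[of l]] by (simp add: g_def mult_ac)
    from sums_summable[OF *]
    have "summable (\<lambda>n. c n / ((of_nat l + of_real a) ^ (2 * k) + of_real (y n ^ (2 * k))))"
      unfolding summable_cmult_iff using of_nat_add_of_real_nonzero[OF \<open>a > 0\<close>] by auto
    from suminf_mult[OF this, of "(of_nat l + of_real a) ^ p"] * show ?thesis by (simp add: sums_iff)
  qed
  with 2 sums_integral_count_space_nat[OF 1] show ?thesis unfolding c_def y_def by auto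
qed

section \<open>The Mellin--Barnes integral\<close>

lemma integrable_exp_neg_abs:
  fixes \<epsilon> :: real
  assumes "\<epsilon> > 0"
  shows "integrable lborel (\<lambda>t. exp (- \<epsilon> * \<bar>t\<bar>))"
proof -
  let ?g = "\<lambda>t. indicator {0..} t *\<^sub>R exp (- \<epsilon> * t)"
  have "(\<lambda>t. exp (- \<epsilon> * t)) integrable_on {0..}"
    using has_integral_exp_minus_to_infinity[OF assms, of 0] by (auto simp: integrable_on_def)
  then have "(\<lambda>t. exp (- \<epsilon> * t)) absolutely_integrable_on {0..}"
    by (rule nonnegative_absolutely_integrable_1) simp
  then have g: "integrable lborel ?g"
    unfolding set_integrable_def by (subst (asm) integrable_completion) auto
  have "integrable lborel (\<lambda>t. ?g t + ?g (0 + (-1) * t))"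
    by (intro Bochner_Integration.integrable_add g lborel_integrable_real_affine) auto
  then show ?thesis
    by (rule Bochner_Integration.integrable_bound) (auto split: split_indicator)
qed

text \<open>Meant for vertical lines, where \<open>sin (Re z)\<close> is a fixed nonzero number and
  the bound gives exponential decay of the reciprocal.\<close>

lemma norm_sin_ge_Re: "norm (sin z) \<ge> \<bar>sin (Re z)\<bar> * exp \<bar>Im z\<bar> / 2" for z :: complex
proof -
  have "exp \<bar>Im z\<bar> \<le> exp (Im z) + exp (- Im z)" by (auto simp: abs_if)
  then have "\<bar>sin (Re z)\<bar> * exp \<bar>Im z\<bar> / 2 \<le> \<bar>sin (Re z)\<bar> * (exp (Im z) + exp (- Im z)) / 2"
    by (intro divide_right_mono mult_left_mono) auto
  also have "\<dots> = \<bar>Re (sin z)\<bar>" by (simp add: Re_sin abs_mult)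
  also have "\<dots> \<le> norm (sin z)" by (rule abs_Re_le_cmod)
  finally show ?thesis .
qed

text \<open>Meant for the horizontal sides of the rectangle, which cross the abscissa of the pole,
  where \<open>norm_sin_ge_Re\<close> degenerates to 0.\<close>

lemma norm_sin_ge_Im: "norm (sin z) \<ge> (exp \<bar>Im z\<bar> - 1) / 2" for z :: complex
proof -
  let ?y = "Im z"
  have "((exp ?y - exp (- ?y)) / 2)\<^sup>2 = (exp (2 * ?y) + inverse (exp (2 * ?y)) - 2) / 4"
  proof -
    have "exp (2 * ?y) = exp ?y * exp ?y" unfolding mult_2 exp_add ..
    then show ?thesis by (simp only: exp_minus) (simp add: power2_eq_square field_simps)
  qed
  also have "\<dots> \<le> (norm (sin z))\<^sup>2" unfolding norm_sin_squared by (intro divide_right_mono) auto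
  finally have "\<bar>(exp ?y - exp (- ?y)) / 2\<bar> \<le> norm (sin z)"
    by (metis abs_le_square_iff abs_norm_cancel)
  moreover have "exp \<bar>?y\<bar> - 1 \<le> \<bar>exp ?y - exp (- ?y)\<bar>"
    by (cases "?y \<ge> 0") (auto simp: abs_if)
  ultimately show ?thesis by simp
qed

lemma sin_pi_eq_0_strip: "sin (of_real pi * z) = 0 \<Longrightarrow> 0 < Re z \<Longrightarrow> Re z < 2 \<Longrightarrow> z = 1" for z :: complex
proof -
  assume "sin (of_real pi * z) = 0" "0 < Re z" "Re z < 2"
  then obtain n :: int where n: "of_real pi * z = of_real (of_int n * pi)"
    by (auto simp: sin_eq_0)
  then have z: "z = of_real (of_int n)" by (simp add: mult.commute)
  then have "n = 1" using \<open>0 < Re z\<close> \<open>Re z < 2\<close> by simp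
  then show "z = 1" using z by simp
qed

lemma integrable_powr_div_sin:
  fixes v \<gamma> :: real
  assumes "v > 0" and "0 < \<gamma>" and "\<gamma> < 1"
  shows "integrable lborel (\<lambda>t. of_real v powr Complex \<gamma> t / sin (of_real pi * Complex \<gamma> t))"
proof (rule Bochner_Integration.integrable_bound)
  have s: "sin (pi * \<gamma>) > 0" using assms by (intro sin_gt_zero) auto
  let ?C = "v powr \<gamma> * 2 / sin (pi * \<gamma>)"
  show "integrable lborel (\<lambda>t. ?C * exp (- pi * \<bar>t\<bar>))"
    by (intro integrable_mult_right integrable_exp_neg_abs) simp
  have ne: "sin (of_real pi * Complex \<gamma> t) \<noteq> 0" for t
    using sin_pi_eq_0_strip[of "Complex \<gamma> t"] assms by (auto simp: complex_eq_iff)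
  have "continuous_on UNIV (\<lambda>t. of_real v powr Complex \<gamma> t / sin (of_real pi * Complex \<gamma> t))"
    unfolding Complex_eq using assms ne[unfolded Complex_eq] by (intro continuous_intros) auto
  then show "(\<lambda>t. of_real v powr Complex \<gamma> t / sin (of_real pi * Complex \<gamma> t)) \<in> borel_measurable lborel"
    by (simp add: borel_measurable_continuous_onI)
  show "AE t in lborel. norm (of_real v powr Complex \<gamma> t / sin (of_real pi * Complex \<gamma> t))
      \<le> norm (?C * exp (- pi * \<bar>t\<bar>))"
  proof (rule AE_I2)
    fix t
    have "sin (pi * \<gamma>) * exp (pi * \<bar>t\<bar>) / 2 \<le> norm (sin (of_real pi * Complex \<gamma> t))"
      using norm_sin_ge_Re[of "of_real pi * Complex \<gamma> t"] s by (simp add: abs_mult)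
    then have "norm (of_real v powr Complex \<gamma> t / sin (of_real pi * Complex \<gamma> t))
        \<le> v powr \<gamma> / (sin (pi * \<gamma>) * exp (pi * \<bar>t\<bar>) / 2)"
      unfolding norm_divide using s \<open>v > 0\<close> by (intro frac_le) (auto simp: norm_powr_real_powr)
    also have "\<dots> = ?C * exp (- pi * \<bar>t\<bar>)" by (simp add: exp_minus field_simps)
    also have "\<dots> \<le> norm (?C * exp (- pi * \<bar>t\<bar>))" using s by simp
    finally show "norm (of_real v powr Complex \<gamma> t / sin (of_real pi * Complex \<gamma> t))
      \<le> norm (?C * exp (- pi * \<bar>t\<bar>))" .
  qed
qed

lemma contour_integral_rectpath_split:
  assumes "continuous_on (path_image (rectpath a b)) f"
  shows "contour_integral (rectpath a b) f =
    contour_integral (linepath a (Complex (Re b) (Im a))) f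
    + contour_integral (linepath (Complex (Re b) (Im a)) b) f
    + contour_integral (linepath b (Complex (Re a) (Im b))) f
    + contour_integral (linepath (Complex (Re a) (Im b)) a) f"
proof -
  let ?c = "Complex (Re b) (Im a)" and ?d = "Complex (Re a) (Im b)"
  have "path_image (rectpath a b) = closed_segment a ?c \<union> closed_segment ?c b
      \<union> closed_segment b ?d \<union> closed_segment ?d a"
    by (auto simp: rectpath_def Let_def path_image_join)
  then have "f contour_integrable_on linepath a ?c" "f contour_integrable_on linepath ?c b"
    "f contour_integrable_on linepath b ?d" "f contour_integrable_on linepath ?d a"
    using assms by (auto intro!: contour_integrable_continuous_linepath elim: continuous_on_subset)
  then show ?thesis by (simp add: rectpath_def Let_def contour_integrable_joinI)
qed

text \<open>Shifting the line by one reproduces the integrand up to the factor \<open>-v\<close>, so the whole integral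
  is determined by the single residue at \<open>1\<close>.\<close>

lemma integral_powr_div_sin:
  fixes v \<gamma> :: real
  assumes v: "v > 0" and \<gamma>: "0 < \<gamma>" "\<gamma> < 1"
  shows "(LBINT t. of_real v powr Complex \<gamma> t / sin (of_real pi * Complex \<gamma> t)) = of_real (2 * v / (1 + v))"
    (is "?J = _")
proof -
  define F where "F z = of_real v powr z / sin (of_real pi * z)" for z :: complex
  define S where "S = {z :: complex. 0 < Re z} \<inter> {z. Re z < 2}"
  have S: "open S" "convex S" "connected S"
    unfolding S_def
    by (auto intro!: open_Int open_halfspace_Re_gt open_halfspace_Re_lt convex_Int
        convex_halfspace_Re_gt convex_halfspace_Re_lt convex_connected)
  have hol: "F holomorphic_on S - {1}"
    unfolding F_def using sin_pi_eq_0_strip by (intro holomorphic_intros) (auto simp: S_def)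
  have res: "residue F 1 = - of_real v / of_real pi"
  proof -
    have "residue (\<lambda>z. of_real v powr z / sin (of_real pi * z)) 1 = of_real v powr 1 / (- of_real pi)"
    proof (rule residue_simple_pole_deriv)
      show "((\<lambda>z. sin (of_real pi * z)) has_field_derivative - of_real pi) (at (1 :: complex))"
        by (auto intro!: derivative_eq_intros simp: cos_of_real)
    qed (use v S in \<open>auto intro!: holomorphic_intros simp: sin_of_real S_def\<close>)
    then show ?thesis using v by (simp add: F_def[abs_def])
  qed
  have shift: "F (Complex (\<gamma> + 1) t) = - of_real v * F (Complex \<gamma> t)" for t
  proof -
    have "Complex (\<gamma> + 1) t = Complex \<gamma> t + 1" by (simp add: complex_eq_iff)
    moreover have "sin (of_real pi * (z + 1)) = - sin (of_real pi * z)" for z :: complex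
      by (simp add: distrib_left sin_add sin_of_real cos_of_real)
    ultimately show ?thesis using v by (simp add: F_def powr_add)
  qed
  define I where "I T = integral {-T..T} (\<lambda>t. F (Complex \<gamma> t))" for T
  define H where "H T = contour_integral (linepath (Complex \<gamma> (-T)) (Complex (\<gamma> + 1) (-T))) F
      + contour_integral (linepath (Complex (\<gamma> + 1) T) (Complex \<gamma> T)) F" for T
  \<comment> \<open>The right side, traversed upwards, contributes \<open>- \<i> * v * I T\<close>
    by \<open>shift\<close>, the left side, traversed downwards, \<open>- \<i> * I T\<close>. The
    enclosed residue \<open>- v / pi\<close> yields \<open>- 2 * \<i> * v\<close>.\<close>
  have contour: "H T - \<i> * (1 + of_real v) * I T = - 2 * \<i> * of_real v" if T: "T > 0" for T
  proof -
    let ?a = "Complex \<gamma> (-T)" and ?b = "Complex (\<gamma> + 1) T"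
    have img: "path_image (rectpath ?a ?b) \<subseteq> S - {1}"
      using \<gamma> T by (auto simp: path_image_rectpath_cbox_minus_box in_cbox_complex_iff in_box_complex_iff S_def)
    have "contour_integral (rectpath ?a ?b) F
        = 2 * pi * \<i> * (\<Sum>p\<in>{1}. winding_number (rectpath ?a ?b) p * residue F p)"
    proof (rule Residue_theorem)
      show "\<forall>z. z \<notin> S \<longrightarrow> winding_number (rectpath ?a ?b) z = 0"
        using img S by (intro allI impI winding_number_zero_outside[where s = S]) auto
    qed (use S hol img in auto)
    also have "\<dots> = - 2 * \<i> * of_real v"
      using \<gamma> T res by (simp add: winding_number_rectpath in_box_complex_iff)
    finally have eq: "contour_integral (rectpath ?a ?b) F = - 2 * \<i> * of_real v" .
    have cont: "continuous_on (path_image (rectpath ?a ?b)) F"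
      using hol img holomorphic_on_imp_continuous_on continuous_on_subset by blast
    have "contour_integral (linepath (Complex (\<gamma> + 1) (-T)) ?b) F
        = \<i> * integral {-T..T} (\<lambda>t. F (Complex (\<gamma> + 1) t))"
      using T by (intro contour_integral_linepath_same_Re) auto
    then have 1: "contour_integral (linepath (Complex (\<gamma> + 1) (-T)) ?b) F = - \<i> * of_real v * I T"
      by (simp add: shift I_def)
    have "contour_integral (linepath ?a (Complex \<gamma> T)) F = \<i> * I T"
      unfolding I_def using T by (intro contour_integral_linepath_same_Re) auto
    then have 2: "contour_integral (linepath (Complex \<gamma> T) ?a) F = - \<i> * I T"
    proof -
      have "closed_segment (Complex \<gamma> T) ?a \<subseteq> path_image (rectpath ?a ?b)"
        by (auto simp: rectpath_def Let_def path_image_join)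
      with cont have "continuous_on (closed_segment (Complex \<gamma> T) ?a) F"
        by (rule continuous_on_subset)
      then show ?thesis
        using \<open>contour_integral (linepath ?a (Complex \<gamma> T)) F = \<i> * I T\<close>
        by (simp add: contour_integral_reverse_linepath)
    qed
    show ?thesis using contour_integral_rectpath_split[OF cont] eq 1 2
      by (simp add: H_def algebra_simps)
  qed
  \<comment> \<open>The maximum covers both \<open>v \<ge> 1\<close>, where the right edge
    dominates, and \<open>v < 1\<close>, where the left edge does.\<close>
  define M where "M = max (v powr \<gamma>) (v powr (\<gamma> + 1))"
  have F_bound: "norm (F z) \<le> M * (2 / (exp (pi * T) - 1))"
    if z: "\<gamma> \<le> Re z" "Re z \<le> \<gamma> + 1" "\<bar>Im z\<bar> = T" "T > 0" for z T
  proof -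
    have "v powr Re z \<le> M"
    proof (cases "v \<ge> 1")
      case True
      then have "v powr Re z \<le> v powr (\<gamma> + 1)" using z by (intro powr_mono) auto
      then show ?thesis by (simp add: M_def)
    next
      case False
      then have "v powr Re z \<le> v powr \<gamma>" using z v by (intro powr_mono') auto
      then show ?thesis by (simp add: M_def)
    qed
    moreover have "(exp (pi * T) - 1) / 2 \<le> norm (sin (of_real pi * z))"
      using norm_sin_ge_Im[of "of_real pi * z"] z by (simp add: abs_mult)
    moreover have "exp (pi * T) - 1 > 0" using z by simp
    ultimately have "norm (F z) \<le> M / ((exp (pi * T) - 1) / 2)"
      unfolding F_def norm_divide using v by (intro frac_le) (auto simp: norm_powr_real_powr M_def le_max_iff_disj)
    then show ?thesis by simp
  qed
  have H_bound: "norm (H T) \<le> 2 * (M * (2 / (exp (pi * T) - 1)))" if T: "T > 0" for T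
  proof -
    let ?B = "M * (2 / (exp (pi * T) - 1))"
    have B: "?B \<ge> 0" using v T by (auto simp: M_def le_max_iff_disj)
    have seg: "norm (contour_integral (linepath p q) F) \<le> ?B * norm (q - p)"
      if "Im p = y" "Im q = y" "\<bar>y\<bar> = T" "Re p \<in> {\<gamma>..\<gamma>+1}" "Re q \<in> {\<gamma>..\<gamma>+1}" for p q y
    proof (rule contour_integral_bound_linepath)
      have sub: "closed_segment p q \<subseteq> cbox (Complex \<gamma> y) (Complex (\<gamma> + 1) y)"
        using that by (intro closed_segment_subset convex_box) (auto simp: in_cbox_complex_iff)
      then have "closed_segment p q \<subseteq> S - {1}"
        using \<gamma> T that by (auto simp: in_cbox_complex_iff S_def)
      then show "F contour_integrable_on linepath p q"
        using hol holomorphic_on_imp_continuous_on continuous_on_subset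
        by (intro contour_integrable_continuous_linepath) blast
      show "norm (F z) \<le> ?B" if "z \<in> closed_segment p q" for z
        using sub that T \<open>\<bar>y\<bar> = T\<close> by (intro F_bound) (auto simp: in_cbox_complex_iff)
    qed (rule B)
    have n: "norm (Complex (\<gamma> + 1) y - Complex \<gamma> y) = 1" for y by (simp add: cmod_def)
    show ?thesis
      unfolding H_def
      using seg[of "Complex \<gamma> (-T)" "-T" "Complex (\<gamma> + 1) (-T)"]
        seg[of "Complex (\<gamma> + 1) T" T "Complex \<gamma> T"] T n[of "-T"] n[of T]
      by (intro order_trans[OF norm_triangle_ineq]) (simp add: norm_minus_commute)
  qed
  have "(\<lambda>n. 2 * (M * (2 / (exp (pi * real n) - 1)))) \<longlonglongrightarrow> 0" by real_asymp
  then have H0: "(\<lambda>n. H (real n)) \<longlonglongrightarrow> 0"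
    by (rule Lim_null_comparison[rotated])
      (use H_bound in \<open>auto intro!: eventually_mono[OF eventually_gt_at_top[of 0]]\<close>)
  have int: "integrable lborel (\<lambda>t. F (Complex \<gamma> t))"
    unfolding F_def by (rule integrable_powr_div_sin[OF v \<gamma>])
  have I: "(\<lambda>n. I (real n)) \<longlonglongrightarrow> ?J"
  proof -
    have "(\<lambda>n. LBINT t. indicator {- real n..real n} t *\<^sub>R F (Complex \<gamma> t))
        \<longlonglongrightarrow> (LBINT t. F (Complex \<gamma> t))"
    proof (rule integral_dominated_convergence)
      show "integrable lborel (\<lambda>t. norm (F (Complex \<gamma> t)))" using int by simp
      show "AE t in lborel. (\<lambda>n. indicator {- real n..real n} t *\<^sub>R F (Complex \<gamma> t)) \<longlonglongrightarrow> F (Complex \<gamma> t)"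
      proof (rule AE_I2, rule tendsto_eventually)
        fix t
        show "\<forall>\<^sub>F n in sequentially. indicator {- real n..real n} t *\<^sub>R F (Complex \<gamma> t) = F (Complex \<gamma> t)"
          using eventually_ge_at_top[of "nat \<lceil>\<bar>t\<bar>\<rceil>"]
        proof eventually_elim
          case (elim n)
          then have "t \<in> {- real n..real n}" by simp linarith
          then show ?case by simp
        qed
      qed
    qed (use int in \<open>auto split: split_indicator\<close>)
    moreover have "(LBINT t. indicator {- real n..real n} t *\<^sub>R F (Complex \<gamma> t)) = I (real n)" for n
    proof -
      have "set_integrable lborel {- real n..real n} (\<lambda>t. F (Complex \<gamma> t))"
        unfolding set_integrable_def using int by (intro integrable_mult_indicator) auto
      from set_borel_integral_eq_integral(2)[OF this] show ?thesis
        by (simp add: I_def set_lebesgue_integral_def)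
    qed
    ultimately show ?thesis by (simp add: F_def)
  qed
  have "(\<lambda>n. H (real n) - \<i> * (1 + of_real v) * I (real n)) \<longlonglongrightarrow> 0 - \<i> * (1 + of_real v) * ?J"
    by (intro tendsto_intros H0 I)
  moreover have "(\<lambda>n. H (real n) - \<i> * (1 + of_real v) * I (real n)) \<longlonglongrightarrow> - 2 * \<i> * of_real v"
    by (intro tendsto_eventually eventually_mono[OF eventually_gt_at_top[of 0]] contour) simp
  ultimately have "0 - \<i> * (1 + of_real v) * ?J = - 2 * \<i> * of_real v"
    by (rule LIMSEQ_unique)
  then have "\<i> * ((1 + of_real v) * ?J) = \<i> * (2 * of_real v)" by (simp add: mult_ac)
  then have "(1 + of_real v) * ?J = 2 * of_real v" unfolding mult_cancel_left by simp
  moreover have "1 + complex_of_real v \<noteq> 0" using v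
    by (auto simp: complex_eq_iff)
  ultimately show ?thesis by (simp add: field_simps)
qed

text \<open>The substitution of \<open>2 * k * t\<close> for \<open>t\<close> normalises the sine to
  \<open>sin (pi * s)\<close> and turns \<open>u\<close> into \<open>u ^ (2 * k)\<close>; the
  condition \<open>c < 2 * k\<close> places the new abscissa in the unit strip of
  \<open>integral_powr_div_sin\<close>.\<close>

lemma mellin_sin_kernel:
  fixes u c :: real
  assumes u: "u > 0" and k: "k > 0" and c: "0 < c" "c < 2 * real k"
  shows "integrable lborel (\<lambda>t. of_real u powr Complex c t
      / (2 * of_nat k * sin (of_real pi * Complex c t / (2 * of_nat k))))"
    and "(LBINT t. of_real u powr Complex c t
      / (2 * of_nat k * sin (of_real pi * Complex c t / (2 * of_nat k))))
      = of_real (2 * u ^ (2 * k) / (1 + u ^ (2 * k)))"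
proof -
  let ?f = "\<lambda>t. of_real u powr Complex c t / (2 * of_nat k * sin (of_real pi * Complex c t / (2 * of_nat k)))"
  let ?g = "\<lambda>t. of_real (u ^ (2 * k)) powr Complex (c / (2 * real k)) t
      / sin (of_real pi * Complex (c / (2 * real k)) t)"
  have v: "u ^ (2 * k) > 0" using u by simp
  have \<gamma>: "0 < c / (2 * real k)" "c / (2 * real k) < 1" using c k by (auto simp: field_simps)
  have fg: "?f (0 + 2 * real k * t) = ?g t / (2 * of_nat k)" for t
  proof -
    have s: "Complex c (0 + 2 * real k * t) = 2 * of_nat k * Complex (c / (2 * real k)) t"
      using k by (simp add: complex_eq_iff)
    have "ln (u ^ (2 * k)) = 2 * real k * ln u" using u by (simp add: ln_realpow)
    then have "of_real u powr (2 * of_nat k * z) = of_real (u ^ (2 * k)) powr z" for z :: complex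
      using u v by (simp only: powr_def of_real_eq_0_iff Ln_of_real[OF u] Ln_of_real[OF v]) (simp add: mult_ac)
    then show ?thesis unfolding s using k by simp
  qed
  have "integrable lborel (\<lambda>t. ?f (0 + 2 * real k * t))"
    unfolding fg by (intro integrable_divide_zero integrable_powr_div_sin[OF v \<gamma>])
  then show "integrable lborel ?f"
    using lborel_integrable_real_affine_iff[of "2 * real k" ?f 0] k by simp
  have "(LBINT t. ?f t) = \<bar>2 * real k\<bar> *\<^sub>R (LBINT t. ?f (0 + 2 * real k * t))"
    using k by (intro lborel_integral_real_affine) simp
  also have "\<dots> = of_real (2 * real k) * ((LBINT t. ?g t) / (2 * of_nat k))"
    unfolding fg integral_divide_zero scaleR_conv_of_real by simp
  also have "\<dots> = (LBINT t. ?g t)" using k by simp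
  also have "\<dots> = of_real (2 * u ^ (2 * k) / (1 + u ^ (2 * k)))"
    by (rule integral_powr_div_sin[OF v \<gamma>])
  finally show "(LBINT t. ?f t) = of_real (2 * u ^ (2 * k) / (1 + u ^ (2 * k)))" .
qed

section \<open>The kernel as an alternating series\<close>

lemma reciprocal_sum_tendsto_zero:
  fixes a x :: real
  assumes "a > 0" and "x > 0" and "k > 0"
  shows "(\<lambda>l. (of_nat l + of_real a) ^ (2 * k - 1)
      / ((of_nat l + of_real a) ^ (2 * k) + of_real (x ^ (2 * k))) :: complex) \<longlonglongrightarrow> 0"
proof (rule Lim_null_comparison)
  show "(\<lambda>l. (real l + a) powr (- 1)) \<longlonglongrightarrow> 0"
    using filterlim_tendsto_add_at_top[OF tendsto_const[of a] filterlim_real_sequentially]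
    by (intro tendsto_neg_powr) (simp_all add: add.commute)
  show "\<forall>\<^sub>F l in sequentially. norm ((of_nat l + of_real a) ^ (2 * k - 1)
      / ((of_nat l + of_real a) ^ (2 * k) + of_real (x ^ (2 * k))) :: complex) \<le> (real l + a) powr (- 1)"
  proof (intro always_eventually allI)
    fix l
    have y: "real l + a > 0" using \<open>a > 0\<close> by simp
    have "(of_nat l + of_real a) ^ (2 * k - 1)
        / ((of_nat l + of_real a) ^ (2 * k) + of_real (x ^ (2 * k)))
        = complex_of_real ((real l + a) ^ (2 * k - 1) / ((real l + a) ^ (2 * k) + x ^ (2 * k)))" by simp
    also have "norm \<dots> = (real l + a) ^ (2 * k - 1) / ((real l + a) ^ (2 * k) + x ^ (2 * k))"
      unfolding norm_of_real using y \<open>x > 0\<close> by simp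
    also have "\<dots> \<le> (real l + a) ^ (2 * k - 1) / (real l + a) ^ (2 * k)"
      using y \<open>x > 0\<close> by (intro frac_le) auto
    also have "\<dots> = (real l + a) powr (- 1)"
    proof -
      have "(real l + a) ^ (2 * k) = (real l + a) ^ (2 * k - 1) * (real l + a)"
        using \<open>k > 0\<close> by (simp flip: power_Suc2)
      then show ?thesis using y by (simp add: powr_minus divide_inverse)
    qed
    finally show "norm ((of_nat l + of_real a) ^ (2 * k - 1)
      / ((of_nat l + of_real a) ^ (2 * k) + of_real (x ^ (2 * k))) :: complex) \<le> (real l + a) powr (- 1)" .
  qed
qed

text \<open>On the line, \<open>1 - s\<close> has real part \<open>1 - c < 0\<close>, outside the
  half-plane where the zeta series converges, so zeta enters as an Euler sum. Because
  \<open>c < 2\<close>, two averaging steps suffice: second differences decay with exponent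
  \<open>c - 3 < -1\<close>. Each term is then \<open>mellin_sin_kernel\<close> at
  \<open>u = (l + a) / x\<close>, and the integrated terms tend to 0, which restores ordinary
  convergence. In particular the kernel does not depend on \<open>c\<close>.\<close>

lemma alt_hurwitz_kernel_sums:
  fixes a c x :: real
  assumes a: "a > 0" and x: "x > 0" and k: "k > 0" and c: "1 < c" "c < 2"
  shows "(\<lambda>l. (-1) ^ l * ((of_nat l + of_real a) ^ (2 * k - 1)
      / ((of_nat l + of_real a) ^ (2 * k) + of_real (x ^ (2 * k)))))
      sums (of_real pi * alt_hurwitz_kernel c x (of_real a) k)"
proof -
  define d where "d t = 2 * of_nat k * sin (of_real pi * Complex c t / (2 * of_nat k))" for t
  define h where "h t = of_real x powr (- Complex c t) / d t" for t
  define \<phi> where "\<phi> l t = h t * (of_nat l + of_real a) powr (- (1 - Complex c t))" for l t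
  define s where "s t = h t * alt_hurwitz_zeta (1 - Complex c t) (of_real a)" for t
  have c2k: "0 < c" "c < 2 * real k"
    using c k by auto
  have la: "real l + a > 0" for l using a by simp
  have \<phi>_eq: "\<phi> l t = of_real (1 / (real l + a)) * (of_real ((real l + a) / x) powr Complex c t / d t)" for l t
  proof -
    have "(of_nat l + of_real a) powr (- (1 - Complex c t))
        = of_real (real l + a) powr Complex c t / of_real (real l + a)"
      using la[of l] unfolding of_nat_add_of_real by (simp only: minus_diff_eq powr_diff) simp
    moreover have "of_real ((real l + a) / x) powr Complex c t
        = of_real (real l + a) powr Complex c t * of_real x powr (- Complex c t)"
    proof -
      have "complex_of_real (real l + a) = of_real x * of_real ((real l + a) / x)" using x by simp
      then have "of_real (real l + a) powr Complex c t
          = of_real x powr Complex c t * of_real ((real l + a) / x) powr Complex c t"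
        using x la[of l] by (metis powr_times_real_left Reals_of_real Re_complex_of_real less_imp_le)
      then show ?thesis using x by (simp add: powr_minus field_simps)
    qed
    ultimately show ?thesis by (simp add: \<phi>_def h_def mult_ac)
  qed
  have int: "integrable lborel (\<phi> l)" for l
    unfolding \<phi>_eq d_def
    by (intro integrable_mult_right mellin_sin_kernel(1) divide_pos_pos la x k c2k)
  have \<phi>_int: "(LBINT t. \<phi> l t) = 2 * ((of_nat l + of_real a) ^ (2 * k - 1)
      / ((of_nat l + of_real a) ^ (2 * k) + of_real (x ^ (2 * k))))" for l
  proof -
    let ?y = "real l + a"
    have "(LBINT t. \<phi> l t) = of_real (1 / ?y) * of_real (2 * (?y / x) ^ (2 * k) / (1 + (?y / x) ^ (2 * k)))"
      unfolding \<phi>_eq d_def integral_mult_right_zero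
      by (subst mellin_sin_kernel(2)[OF divide_pos_pos[OF la x] k c2k]) (rule refl)
    also have "\<dots> = of_real (2 * (?y ^ (2 * k - 1) / (?y ^ (2 * k) + x ^ (2 * k))))"
    proof -
      have 1: "?y ^ (2 * k) = ?y * ?y ^ (2 * k - 1)" using k by (simp flip: power_Suc)
      have p: "x ^ (2 * k) > 0" "?y ^ (2 * k) > 0" using x la[of l] by simp_all
      have "2 * (?y / x) ^ (2 * k) / (1 + (?y / x) ^ (2 * k)) = 2 * ?y ^ (2 * k) / (?y ^ (2 * k) + x ^ (2 * k))"
        unfolding power_divide using p x by (simp add: divide_simps)
      then have "1 / ?y * (2 * (?y / x) ^ (2 * k) / (1 + (?y / x) ^ (2 * k)))
          = 1 / ?y * (2 * (?y * ?y ^ (2 * k - 1)) / (?y ^ (2 * k) + x ^ (2 * k)))"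
        unfolding 1[symmetric] by simp
      also have "\<dots> = 2 * (?y ^ (2 * k - 1) / (?y ^ (2 * k) + x ^ (2 * k)))" using la[of l] by simp
      finally show ?thesis unfolding of_real_mult[symmetric] by (rule arg_cong)
    qed
    finally show ?thesis by simp
  qed
  have zeta: "euler_sums 2 (\<lambda>l. \<phi> l t) (s t)" for t
    unfolding \<phi>_def s_def using c a by (intro euler_sums_cmult euler_sums_alt_hurwitz_zeta) auto
  \<comment> \<open>The cone costs growth \<open>exp (\<bar>t\<bar> / (2 * real k))\<close> in
    \<open>t\<close>, against a sine that gains
    \<open>exp (pi * \<bar>t\<bar> / (2 * real k))\<close>; the surplus is the rate
    \<open>\<epsilon>\<close> used below.\<close>
  define \<delta> where "\<delta> = 1 / (4 * real k)"
  have \<delta>: "\<delta> > 0" "\<delta> \<le> 1 / 2" using k by (simp_all add: \<delta>_def field_simps)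
  let ?w = "\<lambda>t. norm (h t) * exp (2 * \<delta> * norm (1 - Complex c t))"
  let ?B = "\<lambda>l. (4 * real 2 / \<delta>) ^ 2 * (real l + a) powr (c - 3)"
  have sB: "summable ?B" using a c by (intro summable_mult summable_shifted_powr) auto
  have bound: "norm ((fdiff ^^ 2) (\<lambda>l. \<phi> l t) l) \<le> ?B l * ?w t" if l: "real l > 4 * real 2 / \<delta>" for l t
  proof -
    have "norm ((fdiff ^^ 2) (\<lambda>l. \<phi> l t) l)
        = norm (h t) * norm ((fdiff ^^ 2) (\<lambda>l. (of_nat l + of_real a) powr (- (1 - Complex c t))) l)"
      unfolding \<phi>_def fdiff_pow_cmult by (rule norm_mult)
    also have "\<dots> \<le> norm (h t) * (exp (2 * \<delta> * norm (- (1 - Complex c t))) * (4 * real 2 / \<delta>) ^ 2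
        * (real l + a) powr (Re (- (1 - Complex c t)) - real 2))"
      by (intro mult_left_mono fdiff_pow_powr_bound \<delta> a l) auto
    also have "\<dots> = ?B l * ?w t" by (simp add: norm_minus_commute mult_ac)
    finally show ?thesis .
  qed
  have cont_h: "continuous_on UNIV h"
  proof -
    have "sin (of_real pi * (Complex c t / (2 * of_nat k))) \<noteq> 0" for t
    proof
      have Re: "Re (Complex c t / (2 * of_nat k)) = c / (2 * real k)"
        by (metis Re_divide_of_nat complex.sel(1) of_nat_mult of_nat_numeral)
      have lt: "0 < c / (2 * real k)" "c / (2 * real k) < 1" using c2k k by (auto simp: field_simps)
      assume "sin (of_real pi * (Complex c t / (2 * of_nat k))) = 0"
      moreover have "0 < Re (Complex c t / (2 * of_nat k))" "Re (Complex c t / (2 * of_nat k)) < 2"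
        unfolding Re using lt by linarith+
      ultimately have "Complex c t / (2 * of_nat k) = 1" by (rule sin_pi_eq_0_strip)
      then show False using Re lt by simp
    qed
    then show ?thesis
      unfolding h_def d_def Complex_eq times_divide_eq_right using x k
      by (intro continuous_intros) auto
  qed
  have iw: "integrable lborel ?w"
  proof (rule Bochner_Integration.integrable_bound)
    have q: "0 < pi * c / (2 * real k)" "pi * c / (2 * real k) < pi"
      using c2k k pi_gt_zero by (auto simp: field_simps)
    define \<eta> where "\<eta> = sin (pi * c / (2 * real k))"
    have \<eta>: "\<eta> > 0" unfolding \<eta>_def using q by (rule sin_gt_zero)
    define C where "C = x powr (- c) / (real k * \<eta>) * exp (1 / (2 * real k))"
    define \<epsilon> where "\<epsilon> = (pi - 1) / (2 * real k)"
    have "\<epsilon> > 0" using k pi_gt3 by (simp add: \<epsilon>_def)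
    then show "integrable lborel (\<lambda>t. C * exp (- \<epsilon> * \<bar>t\<bar>))"
      by (intro integrable_mult_right integrable_exp_neg_abs)
    have "continuous_on UNIV ?w"
      unfolding Complex_eq by (intro continuous_intros cont_h)
    then show "?w \<in> borel_measurable lborel" by (simp add: borel_measurable_continuous_onI)
    show "AE t in lborel. norm (?w t) \<le> norm (C * exp (- \<epsilon> * \<bar>t\<bar>))"
    proof (rule AE_I2)
      fix t
      have Re: "Re (of_real pi * Complex c t / (2 * of_nat k)) = pi * c / (2 * real k)"
        and Im: "Im (of_real pi * Complex c t / (2 * of_nat k)) = pi * t / (2 * real k)"
        using Re_divide_of_nat[of "of_real pi * Complex c t" "2 * k"]
          Im_divide_of_nat[of "of_real pi * Complex c t" "2 * k"] by simp_all
      have "\<eta> * exp (pi * \<bar>t\<bar> / (2 * real k)) / 2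
          \<le> norm (sin (of_real pi * Complex c t / (2 * of_nat k)))"
        using norm_sin_ge_Re[of "of_real pi * Complex c t / (2 * of_nat k)"] \<eta>
        unfolding Re Im \<eta>_def by (simp add: abs_mult)
      then have "2 * real k * (\<eta> * exp (pi * \<bar>t\<bar> / (2 * real k)) / 2) \<le> norm (d t)"
        unfolding d_def norm_mult using \<eta> by (intro mult_mono) auto
      moreover have "norm (of_real x powr (- Complex c t)) = x powr (- c)"
        using x by (simp add: norm_powr_real_powr)
      ultimately have h: "norm (h t) \<le> x powr (- c) / (2 * real k * (\<eta> * exp (pi * \<bar>t\<bar> / (2 * real k)) / 2))"
        unfolding h_def norm_divide using k \<eta> by (intro frac_le) auto
      have "1 - Complex c t = of_real (1 - c) - \<i> * of_real t" by (simp add: complex_eq_iff)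
      then have "norm (1 - Complex c t) \<le> norm (complex_of_real (1 - c)) + norm (\<i> * complex_of_real t)"
        by (metis norm_triangle_ineq4)
      also have "\<dots> \<le> 1 + \<bar>t\<bar>" using c unfolding norm_of_real norm_mult by simp
      finally have "2 * \<delta> * norm (1 - Complex c t) \<le> 2 * \<delta> * (1 + \<bar>t\<bar>)"
        using \<delta> by (intro mult_left_mono) auto
      also have "\<dots> = 1 / (2 * real k) + \<bar>t\<bar> / (2 * real k)"
        using k by (simp add: \<delta>_def field_simps)
      finally have "?w t \<le> x powr (- c) / (2 * real k * (\<eta> * exp (pi * \<bar>t\<bar> / (2 * real k)) / 2))
          * exp (1 / (2 * real k) + \<bar>t\<bar> / (2 * real k))"
        using h k \<eta> by (intro mult_mono) auto
      also have "\<dots> = C * (exp (\<bar>t\<bar> / (2 * real k)) / exp (pi * \<bar>t\<bar> / (2 * real k)))"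
        unfolding C_def exp_add by simp
      also have "exp (\<bar>t\<bar> / (2 * real k)) / exp (pi * \<bar>t\<bar> / (2 * real k)) = exp (- \<epsilon> * \<bar>t\<bar>)"
        unfolding exp_diff[symmetric] \<epsilon>_def by (intro arg_cong[of _ _ exp]) (simp add: diff_divide_distrib left_diff_distrib)
      finally show "norm (?w t) \<le> norm (C * exp (- \<epsilon> * \<bar>t\<bar>))" by simp
    qed
  qed
  have large: "\<forall>\<^sub>F l in sequentially. real l > 4 * real 2 / \<delta>"
    using eventually_gt_at_top[of "nat \<lceil>4 * real 2 / \<delta>\<rceil>"] by eventually_elim linarith
  have "integrable lborel s \<and> euler_sums 2 (\<lambda>l. LBINT t. \<phi> l t) (LBINT t. s t)"
  proof (rule euler_sums_integral)
    show "summable (\<lambda>l. norm ((fdiff ^^ 2) (\<lambda>l. \<phi> l t) l))" for t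
    proof (rule summable_comparison_test_ev)
      show "summable (\<lambda>l. ?B l * ?w t)" by (intro summable_mult2 sB)
      show "\<forall>\<^sub>F l in sequentially. norm (norm ((fdiff ^^ 2) (\<lambda>l. \<phi> l t) l)) \<le> ?B l * ?w t"
        using large by eventually_elim (simp only: real_norm_def abs_norm_cancel bound)
    qed
    show "summable (\<lambda>l. LBINT t. norm ((fdiff ^^ 2) (\<lambda>l. \<phi> l t) l))"
    proof (rule summable_comparison_test_ev)
      let ?W = "LBINT t. ?w t"
      show "summable (\<lambda>l. ?B l * ?W)" by (intro summable_mult2 sB)
      show "\<forall>\<^sub>F l in sequentially. norm (LBINT t. norm ((fdiff ^^ 2) (\<lambda>l. \<phi> l t) l)) \<le> ?B l * ?W"
        using large
      proof eventually_elim
        case (elim l)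
        have "(LBINT t. norm ((fdiff ^^ 2) (\<lambda>l. \<phi> l t) l)) \<le> (LBINT t. ?B l * ?w t)"
        proof (rule integral_mono')
          show "integrable lborel (\<lambda>t. ?B l * ?w t)" by (intro integrable_mult_right iw)
          show "norm ((fdiff ^^ 2) (\<lambda>l. \<phi> l t) l) \<le> ?B l * ?w t" for t by (rule bound[OF elim])
          then show "0 \<le> ?B l * ?w t" for t by (meson norm_ge_zero order_trans)
        qed
        also have "\<dots> = ?B l * ?W" by (rule integral_mult_right_zero)
        finally show ?case by simp
      qed
    qed
  qed (use int zeta in auto)
  \<comment> \<open>The kernel carries the factor \<open>1 / (2 * pi)\<close>, so \<open>pi\<close>
    times the kernel is half of the integral; this half cancels the 2 in
    \<open>\<phi>_int\<close>.\<close>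
  then have "euler_sums 2 (\<lambda>l. (1 / 2) * (LBINT t. \<phi> l t)) ((1 / 2) * (LBINT t. s t))"
    by (intro euler_sums_cmult) blast
  moreover have "(1 / 2) * (LBINT t. s t) = of_real pi * alt_hurwitz_kernel c x (of_real a) k"
    by (simp add: alt_hurwitz_kernel_def Let_def s_def h_def d_def mult_ac)
  ultimately have "euler_sums 2 (\<lambda>l. (of_nat l + of_real a) ^ (2 * k - 1)
      / ((of_nat l + of_real a) ^ (2 * k) + of_real (x ^ (2 * k))))
      (of_real pi * alt_hurwitz_kernel c x (of_real a) k)"
    unfolding \<phi>_int by simp
  from euler_sums_null[OF reciprocal_sum_tendsto_zero[OF a x k] this] show ?thesis by simp
qed

section \<open>Reciprocity\<close>

text \<open>The subtracted terms arise by Euler summation over \<open>l\<close> from the first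
  \<open>m\<close> terms of the geometric expansion of
  \<open>z ^ (2 * k - 1) / (z ^ (2 * k) + y ^ (2 * k))\<close> in powers of \<open>z / y\<close>.
  That expansion starts with \<open>z ^ (2 * k - 1) / y ^ (2 * k)\<close>, hence the range from
  \<open>p = 1\<close> and the sign \<open>(-1) ^ (p + 1)\<close>.\<close>

definition kernel_remainder :: "real \<Rightarrow> real \<Rightarrow> real \<Rightarrow> nat \<Rightarrow> nat \<Rightarrow> complex" where
  "kernel_remainder c y a k m = alt_hurwitz_kernel c y (of_real a) k
     - 1 / (2 * of_real pi) * (\<Sum>p = 1..m. (-1) ^ (p + 1)
         * euler_ext (2 * int k * int p - 1) (of_real a) / of_real (y ^ (2 * k * p)))"

text \<open>A finite geometric series with its remainder, solved for the remainder. The inductive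
  step replaces \<open>z ^ (2 * k)\<close> by the denominator minus
  \<open>y ^ (2 * k)\<close>.\<close>

lemma geometric_remainder:
  fixes y z :: complex
  assumes "y \<noteq> 0" and "z ^ (2 * k) + y ^ (2 * k) \<noteq> 0" and "k > 0"
  shows "z ^ (2 * k * Suc m - 1) / (z ^ (2 * k) + y ^ (2 * k)) = (-1) ^ m * y ^ (2 * k * m)
    * (z ^ (2 * k - 1) / (z ^ (2 * k) + y ^ (2 * k))
       - (\<Sum>p = 1..m. (-1) ^ (p + 1) * z ^ (2 * k * p - 1) / y ^ (2 * k * p)))"
proof (induction m)
  case 0
  then show ?case by simp
next
  case (Suc m)
  let ?D = "z ^ (2 * k) + y ^ (2 * k)"
  let ?w = "z ^ (2 * k * Suc m - 1)"
  let ?Q = "z ^ (2 * k - 1) / ?D - (\<Sum>p = 1..m. (-1) ^ (p + 1) * z ^ (2 * k * p - 1) / y ^ (2 * k * p))"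
  have w: "z ^ (2 * k * Suc (Suc m) - 1) = ?w * z ^ (2 * k)"
    using \<open>k > 0\<close> by (simp flip: power_add add: algebra_simps)
  have Y: "y ^ (2 * k * Suc m) = y ^ (2 * k) * y ^ (2 * k * m)"
    by (simp add: power_add)
  have "?w * z ^ (2 * k) / ?D = ?w - y ^ (2 * k) * (?w / ?D)"
    using assms(2) by (simp add: field_simps)
  also have "\<dots> = ?w - y ^ (2 * k) * ((-1) ^ m * y ^ (2 * k * m) * ?Q)"
    unfolding Suc.IH ..
  also have "\<dots> = (-1) ^ Suc m * y ^ (2 * k * Suc m) * (?Q - (-1) ^ (Suc m + 1) * ?w / y ^ (2 * k * Suc m))"
  proof -
    have "y ^ (2 * k * Suc m) \<noteq> 0" using assms(1) by simp
    then have "(-1) ^ Suc m * y ^ (2 * k * Suc m) * ((-1) ^ (Suc m + 1) * ?w / y ^ (2 * k * Suc m))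
        = ((-1) ^ Suc m * (-1) ^ (Suc m + 1)) * ?w" by simp
    also have "(-1) ^ Suc m * (-1) ^ (Suc m + 1) = (-1 :: complex)"
      by (simp flip: power_mult_distrib)
    finally show ?thesis unfolding right_diff_distrib Y by simp
  qed
  also have "?Q - (-1) ^ (Suc m + 1) * ?w / y ^ (2 * k * Suc m)
      = z ^ (2 * k - 1) / ?D - (\<Sum>p = 1..Suc m. (-1) ^ (p + 1) * z ^ (2 * k * p - 1) / y ^ (2 * k * p))"
    by (simp add: algebra_simps)
  finally show ?case unfolding w .
qed

lemma euler_ext_pos:
  assumes "k > 0" and "p > 0"
  shows "euler_ext (2 * int k * int p - 1) x = euler_poly (2 * k * p - 1) x"
proof -
  have "2 * int k * int p - 1 = int (2 * k * p - 1)" using assms by (simp add: of_nat_diff)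
  then show ?thesis by (simp add: euler_ext_def)
qed

text \<open>The quotient is \<open>z\<close> to the power \<open>2 * k * q - 1\<close>, written so
  that \<open>q = 0\<close> is included; there it is \<open>1 / z\<close>, which is where the
  convention for the index -1 comes from.\<close>

lemma euler_sums_euler_ext:
  fixes a :: real
  assumes "a > 0" and "k > 0" and "N \<ge> 2 * k * m + 2" and "m > 0" and "q \<le> m"
  shows "euler_sums N (\<lambda>l. (of_nat l + of_real a) ^ (2 * k * m - 1) / (of_nat l + of_real a) ^ (2 * k * (m - q)))
    (euler_ext (2 * int k * int q - 1) (of_real a) / 2)"
proof (cases "q = 0")
  case True
  have "(of_nat l + complex_of_real a) ^ (2 * k * m - 1) / (of_nat l + of_real a) ^ (2 * k * m)
      = (of_nat l + of_real a) powr (- 1)" for l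
  proof -
    have "(of_nat l + complex_of_real a) ^ (2 * k * m)
        = (of_nat l + of_real a) ^ (2 * k * m - 1) * (of_nat l + of_real a)"
      using assms by (simp flip: power_Suc2)
    then show ?thesis using of_nat_add_of_real_nonzero[OF \<open>a > 0\<close>, of l]
      by (simp add: powr_minus divide_inverse)
  qed
  moreover have "euler_sums N (\<lambda>l. (of_nat l + of_real a) powr (- 1)) (alt_hurwitz_zeta 1 (of_real a))"
    using assms by (intro euler_sums_alt_hurwitz_zeta) auto
  ultimately show ?thesis using True by (simp add: euler_ext_def)
next
  case False
  have "2 * k * q \<le> 2 * k * m" "2 * k * q > 0" using assms False by simp_all
  then have N: "N \<ge> (2 * k * q - 1) + 2" using assms(3) by linarith
  have "2 * k * m = 2 * k * (m - q) + 2 * k * q" using assms(5) by (simp flip: distrib_left)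
  then have e: "2 * k * m - 1 = 2 * k * (m - q) + (2 * k * q - 1)" using \<open>2 * k * q > 0\<close> by linarith
  have "(of_nat l + complex_of_real a) ^ (2 * k * m - 1) / (of_nat l + of_real a) ^ (2 * k * (m - q))
      = (of_nat l + of_real a) ^ (2 * k * q - 1)" for l
    unfolding e power_add using of_nat_add_of_real_nonzero[OF \<open>a > 0\<close>, of l] by simp
  then show ?thesis
    using euler_sums_euler_poly[OF \<open>a > 0\<close> N] False \<open>k > 0\<close> by (simp add: euler_ext_pos)
qed

text \<open>Euler summation of \<open>geometric_remainder\<close> term by term. It exhibits the
  remainder as the Euler sum of one rational function, the form in which the summations can be
  interchanged.\<close>

lemma euler_sums_kernel_remainder:
  fixes a c y :: real
  assumes "a > 0" and "y > 0" and "k > 0" and "1 < c" and "c < 2" and "N \<ge> 2 * k * m + 2"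
  shows "euler_sums N (\<lambda>l. (of_nat l + of_real a) ^ (2 * k * Suc m - 1)
      / ((of_nat l + of_real a) ^ (2 * k) + of_real (y ^ (2 * k))))
    ((-1) ^ m * of_real (y ^ (2 * k * m)) * (of_real pi * kernel_remainder c y a k m))"
proof -
  let ?z = "\<lambda>l. of_nat l + complex_of_real a"
  have "euler_sums 0 (\<lambda>l. ?z l ^ (2 * k - 1) / (?z l ^ (2 * k) + of_real (y ^ (2 * k))))
      (of_real pi * alt_hurwitz_kernel c y (of_real a) k)"
    using alt_hurwitz_kernel_sums[OF assms(1-5)] by simp
  then have 1: "euler_sums N (\<lambda>l. ?z l ^ (2 * k - 1) / (?z l ^ (2 * k) + of_real (y ^ (2 * k))))
      (of_real pi * alt_hurwitz_kernel c y (of_real a) k)"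
    by (rule euler_sums_mono) simp
  have "euler_sums N (\<lambda>l. (-1) ^ (p + 1) / of_real (y ^ (2 * k * p)) * ?z l ^ (2 * k * p - 1))
      ((-1) ^ (p + 1) / of_real (y ^ (2 * k * p)) * (euler_ext (2 * int k * int p - 1) (of_real a) / 2))"
    if "p \<in> {1..m}" for p
  proof -
    have "2 * k * p \<le> 2 * k * m" using that by simp
    then have "N \<ge> (2 * k * p - 1) + 2" using assms(6) by linarith
    from euler_sums_euler_poly[OF assms(1) this] show ?thesis
      using that \<open>k > 0\<close> by (intro euler_sums_cmult) (simp add: euler_ext_pos)
  qed
  from euler_sums_diff[OF 1 euler_sums_sum[of "{1..m}", OF this]]
  have "euler_sums N (\<lambda>l. (-1) ^ m * of_real (y ^ (2 * k * m))
      * (?z l ^ (2 * k - 1) / (?z l ^ (2 * k) + of_real (y ^ (2 * k)))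
         - (\<Sum>p = 1..m. (-1) ^ (p + 1) / of_real (y ^ (2 * k * p)) * ?z l ^ (2 * k * p - 1))))
    ((-1) ^ m * of_real (y ^ (2 * k * m)) * (of_real pi * alt_hurwitz_kernel c y (of_real a) k
      - (\<Sum>p = 1..m. (-1) ^ (p + 1) / of_real (y ^ (2 * k * p))
           * (euler_ext (2 * int k * int p - 1) (of_real a) / 2))))"
    by (rule euler_sums_cmult)
  moreover have "(-1) ^ m * of_real (y ^ (2 * k * m))
      * (?z l ^ (2 * k - 1) / (?z l ^ (2 * k) + of_real (y ^ (2 * k)))
         - (\<Sum>p = 1..m. (-1) ^ (p + 1) / of_real (y ^ (2 * k * p)) * ?z l ^ (2 * k * p - 1)))
      = ?z l ^ (2 * k * Suc m - 1) / (?z l ^ (2 * k) + of_real (y ^ (2 * k)))" for l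
  proof -
    have "(real l + a) ^ (2 * k) + y ^ (2 * k) > 0" using assms by (intro add_pos_pos) auto
    then have "complex_of_real ((real l + a) ^ (2 * k) + y ^ (2 * k)) \<noteq> 0"
      unfolding of_real_eq_0_iff by simp
    then have "?z l ^ (2 * k) + of_real y ^ (2 * k) \<noteq> 0" by simp
    from geometric_remainder[OF _ this \<open>k > 0\<close>, of m] show ?thesis using \<open>y > 0\<close>
      by (simp add: mult_ac)
  qed
  moreover have "of_real pi * alt_hurwitz_kernel c y (of_real a) k
      - (\<Sum>p = 1..m. (-1) ^ (p + 1) / of_real (y ^ (2 * k * p))
           * (euler_ext (2 * int k * int p - 1) (of_real a) / 2))
      = of_real pi * kernel_remainder c y a k m"
    unfolding kernel_remainder_def right_diff_distrib
    by (simp add: sum_distrib_left mult_ac)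
  ultimately show ?thesis by simp
qed

text \<open>With \<open>X = (n + b) ^ (2 * k)\<close>, \<open>Z = z ^ (2 * k)\<close> and
  \<open>s = \<sigma> ^ (2 * k)\<close>, this is the identity
  \<open>1 / (Z + s * X) = (1 - X / (X + Z / s)) / Z\<close>. Weighted by
  \<open>1 / (n + b)\<close>, the constant 1 sums to zeta at 1 and the fraction to the kernel at
  \<open>z / \<sigma>\<close>.\<close>

lemma kernel_swap:
  fixes b c z \<sigma> :: real
  assumes "b > 0" and "z > 0" and "\<sigma> > 0" and "k > 0" and "1 < c" and "c < 2"
  shows "(\<Sum>n. (-1) ^ n / of_real (real n + b)
      / (of_real z ^ (2 * k) + of_real ((\<sigma> * (real n + b)) ^ (2 * k))))
    = (euler_ext (- 1) (of_real b) / 2 - of_real pi * alt_hurwitz_kernel c (z / \<sigma>) (of_real b) k)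
        / of_real z ^ (2 * k)"
proof -
  have pw: "(of_nat n + of_real b) powr (- 1) = 1 / complex_of_real (real n + b)" for n
    using of_nat_add_of_real_nonzero[OF \<open>b > 0\<close>, of n] by (simp add: powr_minus_divide)
  have "euler_sums 0 (\<lambda>n. (of_nat n + of_real b) powr (- 1)) (alt_hurwitz_zeta 1 (of_real b))"
  proof (rule euler_sums_null)
    show "(\<lambda>n. (of_nat n + of_real b) powr (- 1 :: complex)) \<longlonglongrightarrow> 0"
      using assms by (intro powr_tendsto_zero) auto
    show "euler_sums 1 (\<lambda>n. (of_nat n + of_real b) powr (- 1)) (alt_hurwitz_zeta 1 (of_real b))"
      using assms by (intro euler_sums_alt_hurwitz_zeta) auto
  qed
  then have "(\<lambda>n. (-1) ^ n * (1 / of_real (real n + b))) sums (euler_ext (- 1) (of_real b) / 2)"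
    by (simp only: euler_sums.simps pw) (simp add: euler_ext_def)
  from sums_divide[OF sums_diff[OF this alt_hurwitz_kernel_sums[OF \<open>b > 0\<close> divide_pos_pos[OF assms(2,3)] assms(4-6)]],
      of "of_real z ^ (2 * k)"]
  have "(\<lambda>n. ((-1) ^ n * (1 / of_real (real n + b)) - (-1) ^ n * ((of_nat n + of_real b) ^ (2 * k - 1)
      / ((of_nat n + of_real b) ^ (2 * k) + of_real ((z / \<sigma>) ^ (2 * k))))) / of_real z ^ (2 * k))
    sums ((euler_ext (- 1) (of_real b) / 2 - of_real pi * alt_hurwitz_kernel c (z / \<sigma>) (of_real b) k)
        / of_real z ^ (2 * k))" .
  moreover have "((-1) ^ n * (1 / of_real (real n + b)) - (-1) ^ n * ((of_nat n + of_real b) ^ (2 * k - 1)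
      / ((of_nat n + of_real b) ^ (2 * k) + of_real ((z / \<sigma>) ^ (2 * k))))) / of_real z ^ (2 * k)
    = (-1) ^ n / of_real (real n + b) / (of_real z ^ (2 * k) + complex_of_real ((\<sigma> * (real n + b)) ^ (2 * k)))" for n
  proof -
    define x where "x = real n + b"
    have x: "x > 0" using \<open>b > 0\<close> by (simp add: x_def)
    have p: "x ^ (2 * k) > 0" "z ^ (2 * k) > 0" "\<sigma> ^ (2 * k) > 0" using x assms by simp_all
    have xk: "x ^ (2 * k) = x * x ^ (2 * k - 1)" using \<open>k > 0\<close> by (simp flip: power_Suc)
    have A: "x ^ (2 * k - 1) / (x ^ (2 * k) + (z / \<sigma>) ^ (2 * k))
        = 1 / x * (x ^ (2 * k) / (x ^ (2 * k) + (z / \<sigma>) ^ (2 * k)))"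
      unfolding xk using x by simp
    have B: "(1 - x ^ (2 * k) / (x ^ (2 * k) + (z / \<sigma>) ^ (2 * k))) / z ^ (2 * k)
        = 1 / (z ^ (2 * k) + (\<sigma> * x) ^ (2 * k))"
    proof -
      have g: "(1 - X / (X + Z / s)) / Z = 1 / (Z + s * X)" if "X > 0" "Z > 0" "s > 0" for X Z s :: real
      proof -
        have "s * X + Z > 0" using that by (intro add_pos_pos mult_pos_pos)
        moreover have "Z * Z + X * (Z * s) > 0" using that by (intro add_pos_pos mult_pos_pos)
        ultimately show ?thesis using that by (simp add: field_simps)
      qed
      show ?thesis unfolding power_divide power_mult_distrib by (rule g[OF p])
    qed
    have "(1 / x - 1 / x * B) / Z = 1 / x * ((1 - B) / Z)" for B Z
      by (simp add: right_diff_distrib diff_divide_distrib)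
    then have "(1 / x - x ^ (2 * k - 1) / (x ^ (2 * k) + (z / \<sigma>) ^ (2 * k))) / z ^ (2 * k)
        = 1 / x * (1 / (z ^ (2 * k) + (\<sigma> * x) ^ (2 * k)))"
      unfolding A B[symmetric] .
    then have "(1 / x - x ^ (2 * k - 1) / (x ^ (2 * k) + (z / \<sigma>) ^ (2 * k))) / z ^ (2 * k)
        = 1 / x / (z ^ (2 * k) + (\<sigma> * x) ^ (2 * k))" by simp
    then have "(-1) ^ n * ((1 / x - x ^ (2 * k - 1) / (x ^ (2 * k) + (z / \<sigma>) ^ (2 * k))) / z ^ (2 * k))
        = (-1) ^ n * (1 / x / (z ^ (2 * k) + (\<sigma> * x) ^ (2 * k)))" by simp
    from arg_cong[OF this, of complex_of_real] show ?thesis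
      by (simp add: x_def diff_divide_distrib right_diff_distrib)
  qed
  ultimately show ?thesis by (simp add: sums_iff)
qed

text \<open>The interchange is applied to the power \<open>p = 2 * k * Suc m - 1\<close>, and
  \<open>N\<close> is one more than the required \<open>p + 2\<close>. The denominator
  \<open>z ^ (2 * k)\<close> left by \<open>kernel_swap\<close> lowers that power to
  \<open>2 * k * m - 1\<close>, matching the weight in the other series.\<close>

lemma kernel_remainder_sums:
  fixes a b c \<sigma> :: real
  assumes "a > 0" and "b > 0" and "\<sigma> > 0" and "k > 0" and "m > 0" and "1 < c" and "c < 2"
    and N: "N = 2 * k * m + 2 * k + 2"
  shows "\<exists>S. (\<lambda>n. (-1) ^ n * of_real ((real n + b) ^ (2 * k * m - 1))
        * kernel_remainder c (\<sigma> * (real n + b)) a k m) sums S \<and>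
    euler_sums N (\<lambda>l. (of_nat l + of_real a) ^ (2 * k * m - 1) * (euler_ext (- 1) (of_real b) / 2
        - of_real pi * alt_hurwitz_kernel c ((real l + a) / \<sigma>) (of_real b) k))
      ((-1) ^ m * of_real pi * of_real (\<sigma> ^ (2 * k * m)) * S)"
proof -
  let ?R = "\<lambda>n. kernel_remainder c (\<sigma> * (real n + b)) a k m"
  let ?C = "(-1) ^ m * complex_of_real pi * of_real (\<sigma> ^ (2 * k * m))"
  have C: "?C \<noteq> 0" using \<open>\<sigma> > 0\<close> by simp
  have s: "euler_sums N (\<lambda>l. (of_nat l + of_real a) ^ (2 * k * Suc m - 1)
      / ((of_nat l + of_real a) ^ (2 * k) + of_real ((\<sigma> * (real n + b)) ^ (2 * k))))
    ((-1) ^ m * of_real ((\<sigma> * (real n + b)) ^ (2 * k * m)) * (of_real pi * ?R n))" for n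
    using assms by (intro euler_sums_kernel_remainder) auto
  have "N \<ge> 2 * k * Suc m - 1 + 2" unfolding N by simp
  from euler_sums_sum_interchange[OF assms(1-4) this s]
  obtain S' where S': "(\<lambda>n. (-1) ^ n / of_real (real n + b) * ((-1) ^ m
        * of_real ((\<sigma> * (real n + b)) ^ (2 * k * m)) * (of_real pi * ?R n))) sums S'"
    and E: "euler_sums N (\<lambda>l. (of_nat l + of_real a) ^ (2 * k * Suc m - 1)
        * (\<Sum>n. (-1) ^ n / of_real (real n + b)
          / ((of_nat l + of_real a) ^ (2 * k) + of_real ((\<sigma> * (real n + b)) ^ (2 * k))))) S'"
    by blast
  have "(-1) ^ n / of_real (real n + b) * ((-1) ^ m
        * of_real ((\<sigma> * (real n + b)) ^ (2 * k * m)) * (of_real pi * ?R n))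
      = ?C * ((-1) ^ n * of_real ((real n + b) ^ (2 * k * m - 1)) * ?R n)" for n
  proof -
    have "real n + b > 0" using \<open>b > 0\<close> by simp
    moreover have "(real n + b) ^ (2 * k * m) = (real n + b) * (real n + b) ^ (2 * k * m - 1)"
      using assms by (simp flip: power_Suc)
    ultimately have "complex_of_real ((\<sigma> * (real n + b)) ^ (2 * k * m)) / of_real (real n + b)
        = of_real (\<sigma> ^ (2 * k * m)) * of_real ((real n + b) ^ (2 * k * m - 1))"
      unfolding power_mult_distrib of_real_divide[symmetric] of_real_mult[symmetric] of_real_eq_iff
      by simp
    then have "(-1) ^ n * (-1) ^ m * of_real pi * ?R n
          * (complex_of_real ((\<sigma> * (real n + b)) ^ (2 * k * m)) / of_real (real n + b))
        = (-1) ^ n * (-1) ^ m * of_real pi * ?R n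
          * (of_real (\<sigma> ^ (2 * k * m)) * of_real ((real n + b) ^ (2 * k * m - 1)))"
      by (rule arg_cong)
    then show ?thesis by (simp only: mult_ac times_divide_eq_left times_divide_eq_right)
  qed
  with S' have "(\<lambda>n. ?C * ((-1) ^ n * of_real ((real n + b) ^ (2 * k * m - 1)) * ?R n)) sums (?C * (S' / ?C))"
    using C by simp
  then have "(\<lambda>n. (-1) ^ n * of_real ((real n + b) ^ (2 * k * m - 1)) * ?R n) sums (S' / ?C)"
    unfolding sums_mult_iff[OF C] .
  moreover have "(of_nat l + of_real a) ^ (2 * k * Suc m - 1)
        * (\<Sum>n. (-1) ^ n / of_real (real n + b)
          / ((of_nat l + of_real a) ^ (2 * k) + of_real ((\<sigma> * (real n + b)) ^ (2 * k))))
      = (of_nat l + of_real a) ^ (2 * k * m - 1) * (euler_ext (- 1) (of_real b) / 2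
        - of_real pi * alt_hurwitz_kernel c ((real l + a) / \<sigma>) (of_real b) k)" for l
  proof -
    have z: "real l + a > 0" using \<open>a > 0\<close> by simp
    have e: "2 * k * Suc m - 1 = (2 * k * m - 1) + 2 * k"
      using assms by (simp add: algebra_simps)
    show ?thesis
      unfolding e of_nat_add_of_real kernel_swap[OF assms(2) z assms(3,4,6,7)] power_add
      using of_nat_add_of_real_nonzero[OF \<open>a > 0\<close>, of l] by simp
  qed
  ultimately show ?thesis using E C by (intro exI[of _ "S' / ?C"]) simp
qed

text \<open>The Euler sum over \<open>l\<close> from \<open>kernel_remainder_sums\<close> still
  contains the bare kernel. Rewriting the kernel as its remainder plus the subtracted terms splits
  it into a convergent series and Euler sums of pure powers, which give the products of two Euler
  values. Uniqueness of Euler sums then compares the two evaluations.\<close>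

lemma kernel_remainder_reciprocity:
  fixes a b c \<sigma> :: real
  assumes "a > 0" and "b > 0" and "\<sigma> > 0" and "k > 0" and "m > 0" and "1 < c" and "c < 2"
  shows "\<exists>S T. (\<lambda>n. (-1) ^ n * of_real ((real n + b) ^ (2 * k * m - 1))
        * kernel_remainder c (\<sigma> * (real n + b)) a k m) sums S \<and>
    (\<lambda>n. (-1) ^ n * of_real ((real n + a) ^ (2 * k * m - 1))
        * kernel_remainder c ((real n + a) / \<sigma>) b k m) sums T \<and>
    (-1) ^ m * of_real pi * of_real (\<sigma> ^ (2 * k * m)) * S = - of_real pi * T
      + 1 / 4 * (\<Sum>q = 0..m. (-1) ^ q * euler_ext (2 * int k * int q - 1) (of_real b)
          * euler_ext (2 * int k * int (m - q) - 1) (of_real a) * of_real (\<sigma> ^ (2 * k * q)))"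
proof -
  let ?z = "\<lambda>l. of_nat l + complex_of_real a"
  let ?e = "\<lambda>q x. euler_ext (2 * int k * int q - 1) (of_real x)"
  let ?M = "2 * k * m - 1"
  define N where "N = 2 * k * m + 2 * k + 2"
  let ?K = "\<lambda>l. alt_hurwitz_kernel c ((real l + a) / \<sigma>) (of_real b) k"
  obtain S where S: "(\<lambda>n. (-1) ^ n * of_real ((real n + b) ^ ?M)
        * kernel_remainder c (\<sigma> * (real n + b)) a k m) sums S"
    and ES: "euler_sums N (\<lambda>l. ?z l ^ ?M * (?e 0 b / 2 - of_real pi * ?K l))
      ((-1) ^ m * of_real pi * of_real (\<sigma> ^ (2 * k * m)) * S)"
    using kernel_remainder_sums[OF assms N_def] by auto
  \<comment> \<open>Exchanging \<open>a\<close> with \<open>b\<close> and \<open>\<sigma>\<close>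
    with \<open>1 / \<sigma>\<close> supplies convergence of the second series.\<close>
  have "1 / \<sigma> > 0" using assms by simp
  from kernel_remainder_sums[OF assms(2,1) this assms(4-7) N_def]
  obtain T where T: "(\<lambda>n. (-1) ^ n * of_real ((real n + a) ^ ?M)
        * kernel_remainder c ((real n + a) / \<sigma>) b k m) sums T"
    by auto
  have nz: "?z l \<noteq> 0" for l using of_nat_add_of_real_nonzero[OF \<open>a > 0\<close>] .
  from T have "euler_sums 0 (\<lambda>n. of_real ((real n + a) ^ ?M) * kernel_remainder c ((real n + a) / \<sigma>) b k m) T"
    by (simp add: mult.assoc)
  then have ET: "euler_sums N (\<lambda>n. of_real ((real n + a) ^ ?M) * kernel_remainder c ((real n + a) / \<sigma>) b k m) T"
    by (rule euler_sums_mono) simp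
  have "euler_sums N (\<lambda>l. (-1) ^ q * ?e q b / 2 * of_real (\<sigma> ^ (2 * k * q)) * (?z l ^ ?M / ?z l ^ (2 * k * q)))
      ((-1) ^ q * ?e q b / 2 * of_real (\<sigma> ^ (2 * k * q)) * (?e (m - q) a / 2))" if "q \<in> {0..m}" for q
    using euler_sums_euler_ext[OF \<open>a > 0\<close> \<open>k > 0\<close> _ \<open>m > 0\<close>, of N "m - q"] that
    by (intro euler_sums_cmult) (simp add: N_def)
  note EP = euler_sums_sum[of "{0..m}", OF this]
  \<comment> \<open>The constant \<open>?e 0 b / 2\<close> left by the partial fraction step becomes
    the term \<open>q = 0\<close>, completing the sum over \<open>1..m\<close> inside the remainder
    to \<open>0..m\<close>.\<close>
  have id: "?z l ^ ?M * (?e 0 b / 2 - of_real pi * ?K l)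
      = - of_real pi * (of_real ((real l + a) ^ ?M) * kernel_remainder c ((real l + a) / \<sigma>) b k m)
        + (\<Sum>q=0..m. (-1) ^ q * ?e q b / 2 * of_real (\<sigma> ^ (2 * k * q)) * (?z l ^ ?M / ?z l ^ (2 * k * q)))" for l
  proof -
    let ?s = "\<Sum>q=1..m. (-1) ^ q * ?e q b / 2 * of_real (\<sigma> ^ (2 * k * q)) * (?z l ^ ?M / ?z l ^ (2 * k * q))"
    have "(\<Sum>q=0..m. (-1) ^ q * ?e q b / 2 * of_real (\<sigma> ^ (2 * k * q)) * (?z l ^ ?M / ?z l ^ (2 * k * q)))
        = ?e 0 b / 2 * ?z l ^ ?M + ?s"
      by (subst sum.atLeast_Suc_atMost) simp_all
    moreover have "of_real pi * (?z l ^ ?M * (1 / (2 * of_real pi) * (\<Sum>q=1..m. (-1) ^ (q + 1) * ?e q b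
        / of_real (((real l + a) / \<sigma>) ^ (2 * k * q))))) = - ?s"
      unfolding sum_distrib_left sum_negf[symmetric]
    proof (rule sum.cong[OF refl])
      fix q
      have "complex_of_real (((real l + a) / \<sigma>) ^ (2 * k * q)) = ?z l ^ (2 * k * q) / of_real (\<sigma> ^ (2 * k * q))"
        by (simp add: power_divide)
      then show "of_real pi * (?z l ^ ?M * (1 / (2 * of_real pi) * ((-1) ^ (q + 1) * ?e q b
          / of_real (((real l + a) / \<sigma>) ^ (2 * k * q)))))
        = - ((-1) ^ q * ?e q b / 2 * of_real (\<sigma> ^ (2 * k * q)) * (?z l ^ ?M / ?z l ^ (2 * k * q)))"
        using nz[of l] by simp
    qed
    ultimately show ?thesis
      unfolding kernel_remainder_def by (simp add: algebra_simps)
  qed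
  have "euler_sums N (\<lambda>l. ?z l ^ ?M * (?e 0 b / 2 - of_real pi * ?K l)) (- of_real pi * T
      + (\<Sum>q = 0..m. (-1) ^ q * ?e q b / 2 * of_real (\<sigma> ^ (2 * k * q)) * (?e (m - q) a / 2)))"
    unfolding id by (intro euler_sums_add euler_sums_cmult ET EP)
  from euler_sums_unique[OF ES this]
  have "(-1) ^ m * of_real pi * of_real (\<sigma> ^ (2 * k * m)) * S = - of_real pi * T
      + (\<Sum>q = 0..m. (-1) ^ q * ?e q b / 2 * of_real (\<sigma> ^ (2 * k * q)) * (?e (m - q) a / 2))" .
  also have "(\<Sum>q = 0..m. (-1) ^ q * ?e q b / 2 * of_real (\<sigma> ^ (2 * k * q)) * (?e (m - q) a / 2))
      = 1 / 4 * (\<Sum>q = 0..m. (-1) ^ q * ?e q b * ?e (m - q) a * of_real (\<sigma> ^ (2 * k * q)))"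
    unfolding sum_distrib_left by (intro sum.cong refl) simp
  finally show ?thesis using S T by blast
qed

text \<open>With \<open>\<sigma> = \<alpha> / pi\<close>, the relation
  \<open>\<alpha> * \<beta> = pi ^ 2\<close> gives \<open>x / \<sigma> = \<beta> * x / pi\<close>
  and \<open>\<beta> * \<sigma> ^ 2 = \<alpha>\<close>, so this is
  \<open>kernel_remainder_reciprocity\<close> in symmetric form. The terms subtracted from the
  kernel are those of \<open>kernel_remainder\<close>; convergence of both series is part of the
  claim.\<close>

theorem theorem1p28:
  fixes \<alpha> \<beta> a b c :: real and k m :: nat
  assumes "\<alpha> > 0" and "\<beta> > 0" and "\<alpha> * \<beta> = pi ^ 2"
    and "k > 0" and "m > 0"
    and "a > 0" and "b > 0"
    and "1 < c" and "c < 2"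
  shows "\<exists>S T :: complex.
    (\<lambda>n. (-1) ^ n * of_real ((real n + b) ^ (2 * k * m - 1)) *
       (alt_hurwitz_kernel_scaled c \<alpha> (real n + b) (of_real a) k
        - 1 / (2 * of_real pi) *
          (\<Sum>p = 1..m. (-1) ^ (p + 1) * euler_ext (2 * int k * int p - 1) (of_real a)
             / of_real ((\<alpha> * (real n + b) / pi) ^ (2 * k * p))))) sums S \<and>
    (\<lambda>n. (-1) ^ n * of_real ((real n + a) ^ (2 * k * m - 1)) *
       (alt_hurwitz_kernel_scaled c \<beta> (real n + a) (of_real b) k
        - 1 / (2 * of_real pi) *
          (\<Sum>p = 1..m. (-1) ^ (p + 1) * euler_ext (2 * int k * int p - 1) (of_real b)
             / of_real ((\<beta> * (real n + a) / pi) ^ (2 * k * p))))) sums T \<and>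
    of_real (\<alpha> ^ (k * m)) * S =
      (-1) ^ (m + 1) * of_real (\<beta> ^ (k * m)) * T
      + 1 / (4 * of_real pi) *
        (\<Sum>p = 0..m. (-1) ^ p * euler_ext (2 * int k * int p - 1) (of_real a)
           * euler_ext (2 * int k * (int m - int p) - 1) (of_real b)
           * of_real (\<alpha> ^ (k * (m - p)) * \<beta> ^ (k * p)))"
proof -
  define \<sigma> where "\<sigma> = \<alpha> / pi"
  have \<sigma>: "\<sigma> > 0" using assms by (simp add: \<sigma>_def)
  have 1: "\<sigma> * x = \<alpha> * x / pi" for x by (simp add: \<sigma>_def)
  have 2: "x / \<sigma> = \<beta> * x / pi" for x
    using assms by (simp add: \<sigma>_def field_simps power2_eq_square)
  let ?e = "\<lambda>q x. euler_ext (2 * int k * int q - 1) (complex_of_real x)"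
  obtain S T where S: "(\<lambda>n. (-1) ^ n * of_real ((real n + b) ^ (2 * k * m - 1))
        * kernel_remainder c (\<sigma> * (real n + b)) a k m) sums S"
    and T: "(\<lambda>n. (-1) ^ n * of_real ((real n + a) ^ (2 * k * m - 1))
        * kernel_remainder c ((real n + a) / \<sigma>) b k m) sums T"
    and eq: "(-1) ^ m * of_real pi * of_real (\<sigma> ^ (2 * k * m)) * S = - of_real pi * T
      + 1 / 4 * (\<Sum>q = 0..m. (-1) ^ q * ?e q b * ?e (m - q) a * of_real (\<sigma> ^ (2 * k * q)))"
    using kernel_remainder_reciprocity[OF assms(6,7) \<sigma> assms(4,5,8,9)] by blast
  have \<sigma>2: "\<beta> ^ (k * q) * \<sigma> ^ (2 * k * q) = \<alpha> ^ (k * q)" for q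
  proof -
    have "\<beta> * \<sigma> ^ 2 = \<alpha>" using assms by (simp add: \<sigma>_def power_divide power2_eq_square field_simps)
    then have "(\<beta> * \<sigma> ^ 2) ^ (k * q) = \<alpha> ^ (k * q)" by simp
    then show ?thesis by (simp only: power_mult_distrib power_mult[symmetric] mult.assoc)
  qed
  \<comment> \<open>Prepares the reflection of the index, \<open>p = m - q\<close>, which moves the
    sign and the powers from the factor in \<open>b\<close> to the factor in
    \<open>a\<close>.\<close>
  have summand: "of_real (\<beta> ^ (k * m)) * ((-1) ^ m * ((-1) ^ q * ?e q b * ?e (m - q) a * of_real (\<sigma> ^ (2 * k * q))))
      = (-1) ^ (m - q) * ?e (m - q) a * euler_ext (2 * int k * (int m - int (m - q)) - 1) (of_real b)
           * of_real (\<alpha> ^ (k * (m - (m - q))) * \<beta> ^ (k * (m - q)))" if "q \<le> m" for q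
  proof -
    have "k * m = k * (m - q) + k * q" using that by (simp flip: distrib_left)
    then have "\<beta> ^ (k * m) * \<sigma> ^ (2 * k * q) = \<beta> ^ (k * (m - q)) * (\<beta> ^ (k * q) * \<sigma> ^ (2 * k * q))"
      by (simp only: power_add mult.assoc)
    then have "\<beta> ^ (k * m) * \<sigma> ^ (2 * k * q) = \<alpha> ^ (k * q) * \<beta> ^ (k * (m - q))"
      unfolding \<sigma>2 by (simp only: mult.commute)
    moreover have "(-1) ^ m * (-1) ^ q = ((-1) ^ (m - q) :: complex)"
    proof -
      have "(-1) ^ m = (-1 :: complex) ^ (m - q) * (-1) ^ q" using that by (simp flip: power_add)
      then show ?thesis by (simp add: mult.assoc flip: power_mult_distrib)
    qed
    ultimately have "of_real (\<beta> ^ (k * m) * \<sigma> ^ (2 * k * q)) * ((-1) ^ m * (-1) ^ q) * (?e q b * ?e (m - q) a)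
        = of_real (\<alpha> ^ (k * q) * \<beta> ^ (k * (m - q))) * (-1) ^ (m - q) * (?e q b * ?e (m - q) a)"
      by (simp only:)
    moreover have "int m - int (m - q) = int q" "m - (m - q) = q" using that by auto
    ultimately show ?thesis by (simp only: of_real_mult mult_ac)
  qed
  \<comment> \<open>The reciprocity is multiplied by
    \<open>(-1) ^ m * \<beta> ^ (k * m) / pi\<close>, which turns
    \<open>\<sigma> ^ (2 * k * m)\<close> into \<open>\<alpha> ^ (k * m)\<close>.\<close>
  have "of_real (\<alpha> ^ (k * m)) * S
      = of_real (\<beta> ^ (k * m)) * (-1) ^ m / of_real pi * ((-1) ^ m * of_real pi * of_real (\<sigma> ^ (2 * k * m)) * S)"
  proof -
    have "(-1) ^ m * (-1) ^ m = (1 :: complex)" by (simp flip: power_mult_distrib)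
    then show ?thesis unfolding \<sigma>2[symmetric] by (simp add: mult_ac)
  qed
  also have "\<dots> = (-1) ^ (m + 1) * of_real (\<beta> ^ (k * m)) * T
      + 1 / (4 * of_real pi) * (\<Sum>q = 0..m. of_real (\<beta> ^ (k * m)) * ((-1) ^ m
          * ((-1) ^ q * ?e q b * ?e (m - q) a * of_real (\<sigma> ^ (2 * k * q)))))"
    unfolding eq sum_distrib_left[symmetric] by (simp add: field_simps)
  also have "(\<Sum>q = 0..m. of_real (\<beta> ^ (k * m)) * ((-1) ^ m
          * ((-1) ^ q * ?e q b * ?e (m - q) a * of_real (\<sigma> ^ (2 * k * q)))))
      = (\<Sum>q = 0..m. (-1) ^ (m - q) * ?e (m - q) a * euler_ext (2 * int k * (int m - int (m - q)) - 1) (of_real b)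
           * of_real (\<alpha> ^ (k * (m - (m - q))) * \<beta> ^ (k * (m - q))))"
    by (intro sum.cong refl summand) simp
  also have "\<dots> = (\<Sum>p = 0..m. (-1) ^ p * ?e p a
           * euler_ext (2 * int k * (int m - int p) - 1) (of_real b)
           * of_real (\<alpha> ^ (k * (m - p)) * \<beta> ^ (k * p)))"
    by (rule sum.reindex_bij_witness[of _ "\<lambda>p. m - p" "\<lambda>p. m - p"]) auto
  finally show ?thesis
    using S T unfolding kernel_remainder_def alt_hurwitz_kernel_scaled_def 1 2 by blast
qed

end
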